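(* Let $R>0$ and let $x^0 \in L^{\infty}(I,\mathbb{R}^d)$ satisfy $\|x^0\|_{L^{\infty}(I,\mathbb{R}^d)} \leq R$. Let $a : \mathbb{R}_+ \times I \times I \to [0,1]$ be Lebesgue measurable and let $\phi : \mathbb{R}_+ \to (0,+\infty)$ be locally Lipschitz continuous, positive and bounded. Let $x(\cdot) \in \mathrm{Lip}_{\mathrm{loc}}(\mathbb{R}_+,L^2(I,\mathbb{R}^d))$ be a solution of the graphon dynamics $$\partial_t x(t,i) = \int_I a(t,i,j)\,\phi(|x(t,i)-x(t,j)|)\,(x(t,j)-x(t,i))\,\mathrm{d}j, \qquad x(0)=x^0 .$$ Then for all times $t \geq 0$ it holds that $$\mathcal{D}(t) \leq \mathcal{D}(0) \exp\Big( -\gamma_R \int_0^t \eta(\mathcal{A}(s))\,\mathrm{d}s \Big),$$ where $\gamma_R := \min_{r \in [0,2R]} \phi(r)$, $\mathcal{D}(t)$ is the diameter of the system at time $t$, and $\eta(\mathcal{A}(s))$ is the scrambling coefficient of the communication weights at time $s$.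
   Context: $I:=[0,1]$ with the Lebesgue measure, $d\geq 1$ is an integer, $\mathbb{R}_+=[0,+\infty)$. The graphon dynamics is understood for almost every $t\geq 0$ and almost every $i\in I$. Diameter: $\mathcal{D}(t) := \operatorname{ess\,sup}_{i,j\in I} |x(t,i)-x(t,j)|$. For almost every $t \geq 0$, $\mathcal{A}(t)$ is the adjacency operator on $L^2(I,\mathbb{R}^d)$ with kernel $a(t)=a(t,\cdot,\cdot)\in L^\infty(I\times I,[0,1])$, i.e. $(\mathcal{A}(t)y)(i)=\int_I a(t,i,j)y(j)\,\mathrm{d}j$. Its scrambling coefficient is $$\eta(\mathcal{A}(t)) := \operatorname{ess\,inf}_{i,j\in I} \int_I \min\{a(t,i,k),a(t,j,k)\}\,\mathrm{d}k .$$ *)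

theory Defs
  imports "HOL-Analysis.Analysis" "HOL-Probability.Essential_Supremum"
begin

abbreviation leb_I :: "real measure" where
  "leb_I \<equiv> lebesgue_on {0..1}"

text \<open>
  Lebesgue measure on the square \<open>I \<times> I\<close>, i.e. the completed planar measure.
\<close>

abbreviation leb_II :: "(real \<times> real) measure" where
  "leb_II \<equiv> lebesgue_on ({0..1} \<times> {0..1})"

text \<open>
  Elements of \<open>L\<^sup>p(I, \<real>\<^sup>d)\<close> are represented by functions on the reals; only their values almost
  everywhere on \<open>I\<close> matter. Everything below is invariant under changing, for each
  time separately, the representative of \<open>x(t)\<close> on a null set.
\<close>

definition in_L2 :: "(real \<Rightarrow> 'a::euclidean_space) \<Rightarrow> bool" where
  "in_L2 f \<longleftrightarrow> f \<in> borel_measurable leb_I \<and> integrable leb_I (\<lambda>i. (norm (f i))\<^sup>2)"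

definition norm_L2 :: "(real \<Rightarrow> 'a::euclidean_space) \<Rightarrow> real" where
  "norm_L2 f = sqrt (LINT i|leb_I. (norm (f i))\<^sup>2)"

definition norm_Linf :: "(real \<Rightarrow> 'a::euclidean_space) \<Rightarrow> ereal" where
  "norm_Linf f = esssup leb_I (\<lambda>i. ereal (norm (f i)))"

definition in_Linf :: "(real \<Rightarrow> 'a::euclidean_space) \<Rightarrow> bool" where
  "in_Linf f \<longleftrightarrow> f \<in> borel_measurable leb_I \<and> norm_Linf f < \<infinity>"

definition Lip_loc_L2 :: "(real \<Rightarrow> real \<Rightarrow> 'a::euclidean_space) \<Rightarrow> bool" where
  "Lip_loc_L2 x \<longleftrightarrow>
     (\<forall>t\<ge>0. in_L2 (x t)) \<and>
     (\<forall>t\<ge>0. \<exists>u>0. \<exists>L. \<forall>r \<in> cball t u \<inter> {0..}. \<forall>s \<in> cball t u \<inter> {0..}.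
        norm_L2 (\<lambda>i. x r i - x s i) \<le> L * \<bar>r - s\<bar>)"

text \<open>
  The time derivative of a curve with values in \<open>L\<^sup>2(I, \<real>\<^sup>d)\<close>: the difference
  quotients converge to \<open>v\<close> in the norm of \<open>L\<^sup>2\<close>. The membership \<open>in_L2 v\<close> is required
  explicitly because \<open>norm_L2\<close> is 0 on functions that are not square integrable.
\<close>

definition has_L2_derivative ::
    "(real \<Rightarrow> real \<Rightarrow> 'a::euclidean_space) \<Rightarrow> (real \<Rightarrow> 'a) \<Rightarrow> real \<Rightarrow> bool" where
  "has_L2_derivative x v t \<longleftrightarrow>
     in_L2 v \<and>
     ((\<lambda>s. norm_L2 (\<lambda>i. (x s i - x t i) /\<^sub>R (s - t) - v i)) \<longlongrightarrow> 0) (at t within {0..})"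

definition graphon_rhs ::
    "(real \<Rightarrow> real \<Rightarrow> real) \<Rightarrow> (real \<Rightarrow> real) \<Rightarrow> (real \<Rightarrow> 'a::euclidean_space) \<Rightarrow> real \<Rightarrow> 'a" where
  "graphon_rhs k \<phi> y i = (LINT j|leb_I. (k i j * \<phi> (norm (y i - y j))) *\<^sub>R (y j - y i))"

text \<open>
  Here \<open>a t\<close> is the kernel of the adjacency operator at time \<open>t\<close>. A curve that is locally
  Lipschitz with values in \<open>L\<^sup>2\<close> is differentiable in \<open>L\<^sup>2\<close> at almost every time, and
  the equation is an identity between elements of \<open>L\<^sup>2\<close> (hence for almost every \<open>i\<close>)
  for almost every \<open>t\<close>.
\<close>

definition graphon_solution ::
    "(real \<Rightarrow> real \<Rightarrow> real \<Rightarrow> real) \<Rightarrow> (real \<Rightarrow> real) \<Rightarrow> (real \<Rightarrow> 'a::euclidean_space)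
      \<Rightarrow> (real \<Rightarrow> real \<Rightarrow> 'a) \<Rightarrow> bool" where
  "graphon_solution a \<phi> x0 x \<longleftrightarrow>
     Lip_loc_L2 x \<and>
     (AE i in leb_I. x 0 i = x0 i) \<and>
     (AE t in lebesgue_on {0..}. has_L2_derivative x (graphon_rhs (a t) \<phi> (x t)) t)"

text \<open>
  The diameter is extended-real valued, since it is not known a priori to be finite.
\<close>

definition diam_ess :: "(real \<Rightarrow> 'a::euclidean_space) \<Rightarrow> ereal" where
  "diam_ess y = esssup leb_II (\<lambda>(i, j). ereal (norm (y i - y j)))"

definition essinf :: "'b measure \<Rightarrow> ('b \<Rightarrow> ereal) \<Rightarrow> ereal" where
  "essinf M f = - esssup M (\<lambda>z. - f z)"

text \<open>
  The scrambling coefficient of the adjacency operator with kernel \<open>k\<close>. For measurable \<open>k\<close>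
  with values in \<open>[0, 1]\<close> the essential infimum lies in \<open>[0, 1]\<close>, so the conversion to a
  real number loses nothing.
\<close>

definition scrambling_coeff :: "(real \<Rightarrow> real \<Rightarrow> real) \<Rightarrow> real" where
  "scrambling_coeff k =
     real_of_ereal (essinf leb_II (\<lambda>(i, j). ereal (LINT l|leb_I. min (k i l) (k j l))))"

text \<open>
  The least value exists whenever \<open>\<phi>\<close> is continuous on \<open>[0, 2R]\<close>.
\<close>

definition gamma_min :: "(real \<Rightarrow> real) \<Rightarrow> real \<Rightarrow> real" where
  "gamma_min \<phi> R = (LEAST m. m \<in> \<phi> ` {0..2 * R})"

end

theory Submission
  imports Defs "HOL-Probability.Probability_Measure"
begin

text \<open>
  Let \<open>w i = v \<bullet> x t i\<close> for a fixed vector \<open>v\<close>, and let \<open>d t\<close> be the claimed bound on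
  \<open>w i - w j\<close>. The functional \<open>E t = \<integral>\<integral> (max 0 (w i - w j - d t))\<^sup>2\<close> vanishes at time 0. Where
  \<open>w i - w j > d t\<close>, the pair \<open>(i, j)\<close> is extremal up to the excess itself, so the interaction contracts
  \<open>w i - w j\<close> at least at the rate of the common weight \<open>\<integral> min (K i k) (K j k)\<close>, up to terms bounded by
  \<open>E t\<close>. Hence \<open>E' \<le> 4 \<Phi> E\<close>, and Gronwall's inequality gives \<open>E = 0\<close>. This works directly with the
  \<open>L\<^sup>2\<close> derivative, without pointwise trajectories.

  The argument is applied twice: with the constant barrier \<open>D(0)\<close>, which gives \<open>D(t) \<le> D(0) \<le> 2 R\<close> and
  so \<open>\<phi> \<ge> \<gamma>\<close> on all occurring distances, and then with the barrier
  \<open>D(0) exp (- \<gamma> \<integral> \<eta>)\<close>, where \<open>\<integral> \<eta>\<close> is approximated from below by functions whose right difference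
  quotients are bounded by \<open>\<eta>\<close> at every time.
\<close>

subsection \<open>Monotonicity from one-sided derivatives\<close>

text \<open>The essential supremum in the diameter need not be attained, and the solution is only a
  curve in L2. No extremal pair of agents can therefore be followed in time, and the diameter at a
  positive time is not even known to be finite beforehand. The functional \<open>E\<close> is finite
  at every time and depends only on the L2 classes. Squaring the positive part gives an integrand
  whose derivative is Lipschitz, so L2 difference quotients control the increment of
  \<open>E\<close> up to second order. The square also closes the estimate: the errors couple the
  excess at (i, j) with the excess at (k, j) and (i, k), and products of these integrate back to
  multiples of \<open>E\<close>. The nonlinearity is frozen: at each fixed time the values of \<phi>
  along the solution are absorbed into a weight \<open>K\<close> between 0 and \<Phi>, so that the
  projection of the equation on any \<open>v\<close> is linear in \<open>w\<close> with this one
  weight. This is what reduces the vector equation to scalar estimates.\<close>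

lemma right_locally_nonincreasing:
  fixes f :: "real \<Rightarrow> real"
  assumes ab: "a \<le> b" and cont: "continuous_on {a..b} f"
    and step: "\<And>t. t \<in> {a..<b} \<Longrightarrow> \<forall>\<^sub>F s in at_right t. f s \<le> f t"
  shows "f b \<le> f a"
proof -
  \<comment> \<open>Continuous induction: continuity puts the supremum of \<open>S\<close> into
    \<open>S\<close>, and the right-hand step at the supremum would push beyond it unless it is
    already \<open>b\<close>.\<close>
  define S where "S = {t \<in> {a..b}. \<forall>r\<in>{a..t}. f r \<le> f a}"
  have aS: "a \<in> S" using ab by (auto simp: S_def)
  have bdd: "bdd_above S" by (auto simp: S_def intro!: bdd_aboveI[of _ b])
  define c where "c = Sup S"
  have c: "c \<in> {a..b}"
    using aS bdd unfolding c_def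
    by (auto intro!: cSup_upper cSup_least simp: S_def)
  have below: "f r \<le> f a" if r: "r \<in> {a..<c}" for r
  proof -
    obtain t where "t \<in> S" "r < t"
      using r less_cSup_iff[OF _ bdd, of r] aS unfolding c_def by (metis atLeastLessThan_iff empty_iff)
    then show ?thesis using r by (auto simp: S_def)
  qed
  have fc: "f c \<le> f a"
  proof (cases "c = a")
    case False
    with c have "a < c" by simp
    have "(f \<longlongrightarrow> f c) (at c within {a..b})"
      using cont c by (auto simp: continuous_on_def)
    then have "(f \<longlongrightarrow> f c) (at c within {a..<c})"
      by (rule tendsto_within_subset) (use c in auto)
    moreover have "at c within {a..<c} = at_left c"
      using \<open>a < c\<close> by (intro at_within_nhd[of _ "{a<..}"]) auto
    ultimately have "(f \<longlongrightarrow> f c) (at_left c)" by simp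
    moreover have "\<forall>\<^sub>F r in at_left c. f r \<le> f a"
      using eventually_at_left_real[OF \<open>a < c\<close>] by eventually_elim (auto intro: below)
    ultimately show ?thesis
      by (intro tendsto_upperbound[of f "f c" "at_left c"]) auto
  qed simp
  have "c = b"
  proof (rule ccontr)
    assume "c \<noteq> b"
    with c have cb: "c < b" by simp
    then obtain e where e: "e > c" "\<And>s. c < s \<Longrightarrow> s < e \<Longrightarrow> f s \<le> f c"
      using step[of c] c unfolding eventually_at_right_field by auto
    define m where "m = (c + min e b) / 2"
    have m: "c < m" "m < e" "m \<le> b" using e cb by (auto simp: m_def min_def field_simps)
    have "f r \<le> f a" if "r \<in> {a..m}" for r
    proof -
      consider "r < c" | "r = c" | "r > c" by linarith
      then show ?thesis using below[of r] fc e(2)[of r] that m by cases auto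
    qed
    then have "m \<in> S" using m c by (auto simp: S_def)
    then have "m \<le> c" unfolding c_def using bdd by (rule cSup_upper)
    with m show False by simp
  qed
  with fc show ?thesis by simp
qed

section \<open>Indefinite integrals of indicators\<close>

lemma measure_Int_atLeastAtMost_diff:
  fixes A :: "real set"
  assumes "A \<in> sets lebesgue" "a \<le> s" "s \<le> t"
  shows "measure lebesgue (A \<inter> {a..t}) = measure lebesgue (A \<inter> {a..s}) + measure lebesgue (A \<inter> {s<..t})"
proof -
  have "A \<inter> {a..t} = (A \<inter> {a..s}) \<union> (A \<inter> {s<..t})" using assms by auto
  moreover have "A \<inter> {a..s} \<in> lmeasurable" "A \<inter> {s<..t} \<in> lmeasurable"
    using assms
    by (auto intro!: bounded_set_imp_lmeasurable)
  moreover have "(A \<inter> {a..s}) \<inter> (A \<inter> {s<..t}) = {}" by auto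
  ultimately show ?thesis by (simp add: measure_Un3)
qed

lemma measure_Int_greaterThanAtMost_le:
  fixes A :: "real set"
  assumes "A \<in> sets lebesgue" "s \<le> t"
  shows "measure lebesgue (A \<inter> {s<..t}) \<le> t - s"
proof -
  have "measure lebesgue (A \<inter> {s<..t}) \<le> measure lebesgue {s<..t}"
    using assms by (intro measure_mono_fmeasurable bounded_set_imp_lmeasurable) auto
  then show ?thesis using assms by simp
qed

lemma continuous_on_measure_Int:
  fixes A :: "real set"
  assumes "A \<in> sets lebesgue"
  shows "continuous_on {a..b} (\<lambda>t. measure lebesgue (A \<inter> {a..t}))"
proof -
  have "\<bar>measure lebesgue (A \<inter> {a..t}) - measure lebesgue (A \<inter> {a..s})\<bar> \<le> \<bar>t - s\<bar>"
    if "a \<le> s" "a \<le> t" for s t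
    using measure_Int_atLeastAtMost_diff[OF assms, of a s t] measure_Int_atLeastAtMost_diff[OF assms, of a t s]
      measure_Int_greaterThanAtMost_le[OF assms, of s t] measure_Int_greaterThanAtMost_le[OF assms, of t s] that
    by (cases "s \<le> t") auto
  then have "1-lipschitz_on {a..b} (\<lambda>t. measure lebesgue (A \<inter> {a..t}))"
    by (intro lipschitz_onI) (auto simp: dist_real_def)
  then show ?thesis by (rule lipschitz_on_continuous_on)
qed

text \<open>The null set on which only the bound \<open>L\<close> is known is covered by an open set \<open>U\<close> of small
  measure; subtracting \<open>L\<close> times the measure of \<open>U \<inter> [a, t]\<close> absorbs the growth there.\<close>

lemma ae_nonincreasing:
  fixes f :: "real \<Rightarrow> real"
  assumes ab: "a \<le> b" and cont: "continuous_on {a..b} f"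
    and L: "\<And>t. t \<in> {a..<b} \<Longrightarrow> \<forall>\<^sub>F s in at_right t. f s - f t \<le> L * (s - t)"
    and ae: "AE t in lebesgue. t \<in> {a..<b} \<longrightarrow> (\<forall>e>0. \<forall>\<^sub>F s in at_right t. f s - f t \<le> e * (s - t))"
  shows "f b \<le> f a"
proof (rule field_le_epsilon)
  fix e :: real assume e: "e > 0"
  define L' where "L' = max L 0"
  \<comment> \<open>One number serves twice: as the measure allowed for the open cover, which costs
    at most \<open>L' * d\<close>, and as the slope allowed elsewhere, which costs
    \<open>d * (b - a)\<close>. The two costs add up to at most \<open>e\<close>; the summand 1
    keeps the denominator positive.\<close>
  define d where "d = e / (b - a + L' + 1)"
  have d: "d > 0" "d * (b - a + L' + 1) = e"
    using e ab by (auto simp: d_def L'_def intro!: divide_pos_pos)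
  obtain N where N: "N \<in> null_sets lebesgue"
    "\<And>t. t \<in> {a..<b} \<Longrightarrow> t \<notin> N \<Longrightarrow> \<forall>e>0. \<forall>\<^sub>F s in at_right t. f s - f t \<le> e * (s - t)"
    using ae by (elim AE_E3) auto
  obtain U where U: "open U" "N \<subseteq> U" "U - N \<in> lmeasurable" "emeasure lebesgue (U - N) < ennreal d"
    using sets_lebesgue_outer_open[of N d] N(1) d by auto
  have Us: "U \<in> sets lebesgue" using U(1) by (simp add: borel_open)
  define h where "h t = measure lebesgue (U \<inter> {a..t})" for t
  have hb: "h b \<le> d"
  proof -
    have "emeasure lebesgue (U \<inter> {a..b}) \<le> emeasure lebesgue ((U - N) \<union> N)"
      using N(1) Us by (intro emeasure_mono) auto
    also have "\<dots> = emeasure lebesgue (U - N)"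
      using N(1) Us by (intro emeasure_Un_null_set) auto
    also have "\<dots> \<le> ennreal d" using U(4) by simp
    finally show ?thesis unfolding h_def measure_def using d by (simp add: enn2real_leI)
  qed
  have ha: "h a = 0" unfolding h_def
  proof -
    have "U \<inter> {a..a} \<in> null_sets lebesgue"
      by (rule null_sets_subset[of "{a}"]) (auto simp: Us)
    then show "measure lebesgue (U \<inter> {a..a}) = 0" by (simp add: measure_def null_sets_def)
  qed
  define k where "k t = f t - L' * h t - d * (t - a)" for t
  have "k b \<le> k a"
  proof (rule right_locally_nonincreasing[OF ab])
    show "continuous_on {a..b} k"
      unfolding k_def h_def by (intro continuous_intros cont continuous_on_measure_Int Us)
    fix t assume t: "t \<in> {a..<b}"
    have hinc: "h s = h t + measure lebesgue (U \<inter> {t<..s})" if "s > t" for s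
      unfolding h_def using measure_Int_atLeastAtMost_diff[OF Us, of a t s] t that by auto
    have gt: "\<forall>\<^sub>F s in at_right t. s > t" by (simp add: eventually_at_right_less)
    show "\<forall>\<^sub>F s in at_right t. k s \<le> k t"
    proof (cases "t \<in> N")
      case True
      then have "t \<in> U" using U by auto
      then obtain r where r: "r > 0" "ball t r \<subseteq> U" using U(1) openE by blast
      have "\<forall>\<^sub>F s in at_right t. s \<in> {t<..<t + r}"
        using eventually_at_right_real[of t "t + r"] r by simp
      with L[OF t] show ?thesis
      proof eventually_elim
        case (elim s)
        have "U \<inter> {t<..s} = {t<..s}" using r elim by (auto simp: dist_real_def subset_eq)
        then have "h s = h t + (s - t)" using hinc[of s] elim by simp
        then have "L' * h s = L' * h t + L' * (s - t)" by (simp add: distrib_left)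
        moreover have "f s - f t \<le> L' * (s - t)"
          using elim mult_right_mono[of L L' "s - t"] unfolding L'_def by (smt (verit) greaterThanLessThan_iff)
        moreover have "0 \<le> d * (s - t)" using elim d by simp
        ultimately show ?case by (simp add: k_def algebra_simps)
      qed
    next
      case False
      with N(2)[OF t] d have "\<forall>\<^sub>F s in at_right t. f s - f t \<le> d * (s - t)" by blast
      with gt show ?thesis
      proof eventually_elim
        case (elim s)
        have "h t \<le> h s" using hinc[of s] elim by simp
        then have "L' * h t \<le> L' * h s" by (intro mult_left_mono) (auto simp: L'_def)
        with elim show ?case by (simp add: k_def algebra_simps)
      qed
    qed
  qed
  then have "f b \<le> f a + L' * h b + d * (b - a)" by (simp add: k_def ha)
  also have "L' * h b \<le> L' * d" using hb by (intro mult_left_mono) (auto simp: L'_def)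
  also have "f a + L' * d + d * (b - a) \<le> f a + d * (b - a + L' + 1)"
    using d by (simp add: algebra_simps)
  finally show "f b \<le> f a + e" using d by simp
qed

text \<open>A substitute for Lebesgue's differentiation theorem: \<open>u\<close> is a finite sum of multiples of
  indefinite integrals of indicators of closed sets \<open>C\<close>. For those, the right upper bound on difference
  quotients holds at every point, since outside \<open>C\<close> the function is locally constant.\<close>

lemma right_subderivative_approx:
  fixes g :: "real \<Rightarrow> real"
  assumes T: "T \<ge> 0" and gm: "g \<in> borel_measurable (lebesgue_on {0..T})"
    and g: "\<And>t. t \<in> {0..T} \<Longrightarrow> 0 \<le> g t \<and> g t \<le> G" and e: "e > 0"
  obtains u :: "real \<Rightarrow> real" where
    "u 0 = 0" "\<And>s t. 0 \<le> s \<Longrightarrow> s \<le> t \<Longrightarrow> 0 \<le> u t - u s \<and> u t - u s \<le> G * (t - s)"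
    "\<And>t. t \<in> {0..<T} \<Longrightarrow> \<forall>\<^sub>F s in at_right t. u s - u t \<le> g t * (s - t)"
    "(LINT t|lebesgue_on {0..T}. g t) - e \<le> u T"
proof -
  have G0: "0 \<le> G" using g[of 0] T by auto
  obtain n :: nat where n: "n > 0" "G * T / real n \<le> e / 2"
  proof -
    obtain n :: nat where "real n > 2 * (G * T) / e" using reals_Archimedean2 by blast
    moreover have "2 * (G * T) / e \<ge> 0" using G0 T e by simp
    ultimately have "n > 0" by (metis less_le_not_le of_nat_0_less_iff order_le_less_trans)
    with \<open>real n > _\<close> show ?thesis using e by (intro that[of n]) (auto simp: field_simps)
  qed
  define c where "c = G / real n"
  have c0: "0 \<le> c" using G0 by (simp add: c_def)
  \<comment> \<open>Layer-cake decomposition: \<open>c\<close> times the number of \<open>k\<close>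
    in 1..n with \<open>t\<close> in \<open>A k\<close> is \<open>g t\<close> rounded down to a
    multiple of \<open>c\<close>. Counting from 1 rather than 0 keeps the sum below
    \<open>g t\<close>, and the rounding error integrates to at most \<open>c * T\<close>, that is,
    half of \<open>e\<close>.\<close>
  define A where "A k = {t \<in> {0..T}. c * real k \<le> g t}" for k :: nat
  have As: "A k \<in> sets lebesgue" for k
  proof -
    have "A k = {t \<in> space (lebesgue_on {0..T}). c * real k \<le> g t}" by (auto simp: A_def)
    also have "\<dots> \<in> sets (lebesgue_on {0..T})" using gm by measurable
    finally show ?thesis by (subst (asm) sets_restrict_space_iff) auto
  qed
  \<comment> \<open>Replacing each layer by a closed subset loses measure at most \<open>r\<close>,
    hence \<open>c * n * r = G * r\<close> in total, the other half of \<open>e\<close>.\<close>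
  define r where "r = e / (2 * (G + 1))"
  have r: "r > 0" "G * r \<le> e / 2" using e G0 by (auto simp: r_def field_simps)
  have "\<exists>C. closed C \<and> C \<subseteq> A k \<and> A k - C \<in> lmeasurable \<and> measure lebesgue (A k - C) \<le> r" for k
  proof -
    obtain C where "closed C" "C \<subseteq> A k" "A k - C \<in> lmeasurable" "emeasure lebesgue (A k - C) < ennreal r"
      using sets_lebesgue_inner_closed[OF As r(1)] by blast
    then show ?thesis using r by (intro exI[of _ C]) (auto simp: measure_def intro!: enn2real_leI)
  qed
  then obtain C where C: "\<And>k. closed (C k)" "\<And>k. C k \<subseteq> A k" "\<And>k. A k - C k \<in> lmeasurable"
    "\<And>k. measure lebesgue (A k - C k) \<le> r" by metis
  have Cs: "C k \<in> sets lebesgue" for k using C(1)[of k] by (simp add: borel_closed)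
  define m where "m k t = measure lebesgue (C k \<inter> {0..t})" for k t
  define u where "u t = c * (\<Sum>k=1..n. m k t)" for t
  have minc: "m k t = m k s + measure lebesgue (C k \<inter> {s<..t})" if "0 \<le> s" "s \<le> t" for k s t
    unfolding m_def using measure_Int_atLeastAtMost_diff[OF Cs that] .
  have mlip: "0 \<le> m k t - m k s" "m k t - m k s \<le> t - s" if "0 \<le> s" "s \<le> t" for k s t
    using minc[OF that] measure_Int_greaterThanAtMost_le[OF Cs that(2)] by auto
  have level: "(\<Sum>k=1..n. if c * real k \<le> y then 1 else 0) * c \<le> y" if "0 \<le> y" for y
  proof (cases "c = 0")
    case False
    then have "c > 0" using c0 by simp
    have "(\<Sum>k=1..n. if c * real k \<le> y then 1 else 0) = real (card {k \<in> {1..n}. c * real k \<le> y})"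
      by (simp add: sum.If_cases Int_def)
    also have "card {k \<in> {1..n}. c * real k \<le> y} \<le> card {1..nat \<lfloor>y / c\<rfloor>}"
      using \<open>c > 0\<close> that by (intro card_mono) (auto simp: le_nat_floor field_simps)
    also have "real (card {1..nat \<lfloor>y / c\<rfloor>}) \<le> y / c" using \<open>c > 0\<close> that by simp
    finally show ?thesis using \<open>c > 0\<close> by (simp add: field_simps)
  qed (use that in auto)
  have level': "y \<le> (\<Sum>k=1..n. if c * real k \<le> y then 1 else 0) * c + c" if "0 \<le> y" "y \<le> G" for y
  proof (cases "c = 0")
    case True then show ?thesis using that n by (auto simp: c_def)
  next
    case False
    then have "c > 0" using c0 by simp
    have "y / c \<le> real n"
      using that n \<open>c > 0\<close> by (simp add: pos_divide_le_eq) (simp add: c_def)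
    then have le: "nat \<lfloor>y / c\<rfloor> \<le> n"
      using nat_mono[OF floor_mono] by fastforce
    have "{1..nat \<lfloor>y / c\<rfloor>} \<subseteq> {k \<in> {1..n}. c * real k \<le> y}"
    proof safe
      fix k assume k: "k \<in> {1..nat \<lfloor>y / c\<rfloor>}"
      then show "k \<in> {1..n}" using le by auto
      have "real k \<le> y / c" using k that \<open>c > 0\<close> by (simp add: le_nat_iff le_floor_iff)
      then show "c * real k \<le> y" using \<open>c > 0\<close> by (simp add: field_simps)
    qed
    then have "nat \<lfloor>y / c\<rfloor> \<le> card {k \<in> {1..n}. c * real k \<le> y}"
      using card_mono[of "{k \<in> {1..n}. c * real k \<le> y}" "{1..nat \<lfloor>y / c\<rfloor>}"] by simp
    moreover have "y / c \<le> real (nat \<lfloor>y / c\<rfloor>) + 1" using that \<open>c > 0\<close> by linarith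
    ultimately have "y / c \<le> real (card {k \<in> {1..n}. c * real k \<le> y}) + 1" by linarith
    then have "y \<le> (real (card {k \<in> {1..n}. c * real k \<le> y}) + 1) * c" using \<open>c > 0\<close> by (simp add: field_simps)
    then show ?thesis by (simp add: sum.If_cases Int_def algebra_simps)
  qed
  show ?thesis
  proof (rule that[of u])
    have "C k \<inter> {0..0} \<in> null_sets lebesgue" for k
      by (rule null_sets_subset[of "{0}"]) (auto simp: Cs)
    then have "m k 0 = 0" for k by (simp add: m_def measure_def null_sets_def)
    then show "u 0 = 0" by (simp add: u_def)
    show "0 \<le> u t - u s \<and> u t - u s \<le> G * (t - s)" if "0 \<le> s" "s \<le> t" for s t
    proof -
      have *: "u t - u s = c * (\<Sum>k=1..n. m k t - m k s)"
        by (simp add: u_def sum_subtractf right_diff_distrib)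
      have "(\<Sum>k=1..n. m k t - m k s) \<le> (\<Sum>k=1..n. t - s)"
        by (intro sum_mono mlip that)
      then have "u t - u s \<le> c * (real n * (t - s))" unfolding * using c0 by (intro mult_left_mono) auto
      also have "\<dots> = G * (t - s)" using n by (simp add: c_def)
      finally show ?thesis unfolding * using c0 mlip[OF that] by (auto intro!: mult_nonneg_nonneg sum_nonneg)
    qed
    show "\<forall>\<^sub>F s in at_right t. u s - u t \<le> g t * (s - t)" if t: "t \<in> {0..<T}" for t
    proof -
      have "\<forall>\<^sub>F s in at_right t. m k s - m k t \<le> (if c * real k \<le> g t then 1 else 0) * (s - t)" for k
      proof (cases "t \<in> C k")
        case True
        then have "c * real k \<le> g t" using C(2)[of k] by (auto simp: A_def)
        moreover have "\<forall>\<^sub>F s in at_right t. s > t" by (simp add: eventually_at_right_less)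
        ultimately show ?thesis using t by (auto elim!: eventually_mono intro: mlip)
      next
        case False
        then obtain d where d: "d > 0" "ball t d \<subseteq> - C k"
          using C(1)[of k] by (metis ComplI open_Compl openE)
        have "\<forall>\<^sub>F s in at_right t. s \<in> {t<..<t + d}"
          using eventually_at_right_real[of t "t + d"] d by simp
        then show ?thesis
        proof eventually_elim
          case (elim s)
          have "C k \<inter> {t<..s} = {}" using d elim by (auto simp: dist_real_def subset_eq)
          then have "m k s = m k t" using minc[of t s k] elim t by simp
          then show ?case using elim by simp
        qed
      qed
      then have "\<forall>\<^sub>F s in at_right t. \<forall>k\<in>{1..n}. m k s - m k t \<le> (if c * real k \<le> g t then 1 else 0) * (s - t)"
        by (intro eventually_ball_finite) auto
      moreover have "\<forall>\<^sub>F s in at_right t. s > t" by (simp add: eventually_at_right_less)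
      ultimately show ?thesis
      proof eventually_elim
        case (elim s)
        have "u s - u t = c * (\<Sum>k=1..n. m k s - m k t)"
          by (simp add: u_def sum_subtractf right_diff_distrib)
        also have "\<dots> \<le> c * (\<Sum>k=1..n. (if c * real k \<le> g t then 1 else 0) * (s - t))"
          using c0 elim by (intro mult_left_mono sum_mono) auto
        also have "\<dots> = ((\<Sum>k=1..n. if c * real k \<le> g t then 1 else 0) * c) * (s - t)"
          by (subst sum_distrib_right[symmetric]) (simp only: mult_ac)
        also have "\<dots> \<le> g t * (s - t)"
          using elim t g[of t] level[of "g t"] by (intro mult_right_mono) auto
        finally show ?case .
      qed
    qed
    have Aon: "A k \<in> sets (lebesgue_on {0..T})" for k
      using As[of k] by (subst sets_restrict_space_iff) (auto simp: A_def)
    interpret finite_measure "lebesgue_on {0..T}"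
      by (intro finite_measure_lebesgue_on bounded_set_imp_lmeasurable) auto
    have int1: "integrable (lebesgue_on {0..T}) (indicator (A k) :: real \<Rightarrow> real)" for k
      using Aon[of k] by (intro integrable_real_indicator) (auto simp: less_top[symmetric])
    have int2: "(LINT t|lebesgue_on {0..T}. indicator (A k) t) = measure lebesgue (A k)" for k
    proof -
      have "A k \<inter> {0..T} = A k" "A k \<subseteq> {0..T}" by (auto simp: A_def)
      then show ?thesis by (simp add: measure_restrict_space)
    qed
    have fin: "integrable (lebesgue_on {0..T}) (\<lambda>_. c)"
      by (rule integrable_const)
    have gint: "integrable (lebesgue_on {0..T}) g"
      using g by (intro integrable_const_bound[of _ G] gm AE_I2) auto
    have "(LINT t|lebesgue_on {0..T}. g t) \<le> (LINT t|lebesgue_on {0..T}. (\<Sum>k=1..n. indicator (A k) t) * c + c)"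
    proof (rule integral_mono)
      show "integrable (lebesgue_on {0..T}) (\<lambda>t. (\<Sum>k=1..n. indicator (A k) t) * c + c)"
        using int1 fin by (intro Bochner_Integration.integrable_add integrable_mult_left Bochner_Integration.integrable_sum) auto
      show "integrable (lebesgue_on {0..T}) g" by (fact gint)
      fix t assume "t \<in> space (lebesgue_on {0..T})"
      then have t: "t \<in> {0..T}" by simp
      have "indicator (A k) t = (if c * real k \<le> g t then 1 else (0::real))" for k
        using t by (auto simp: A_def)
      then show "g t \<le> (\<Sum>k=1..n. indicator (A k) t) * c + c" using level'[of "g t"] g[OF t] by simp
    qed
    also have "\<dots> = (\<Sum>k=1..n. measure lebesgue (A k)) * c + c * T"
    proof -
      have "(LINT t|lebesgue_on {0..T}. (\<Sum>k=1..n. indicator (A k) t) * c + c)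
          = (LINT t|lebesgue_on {0..T}. (\<Sum>k=1..n. indicator (A k) t) * c) + (LINT t|lebesgue_on {0..T}. c)"
        using int1 fin by (intro Bochner_Integration.integral_add integrable_mult_left Bochner_Integration.integrable_sum) auto
      also have "(LINT t|lebesgue_on {0..T}. (\<Sum>k=1..n. indicator (A k) t) * c)
          = (\<Sum>k=1..n. LINT t|lebesgue_on {0..T}. indicator (A k) t) * c"
        using int1 by (subst Bochner_Integration.integral_sum[symmetric]) auto
      also have "(LINT t|lebesgue_on {0..T}. c) = c * T"
        using T by (simp add: measure_restrict_space space_restrict_space)
      finally show ?thesis by (simp only: int2)
    qed
    also have "\<dots> \<le> (\<Sum>k=1..n. m k T + r) * c + c * T"
    proof -
      have "measure lebesgue (A k) \<le> m k T + r" for k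
      proof -
        have AC: "A k = C k \<union> (A k - C k)" "C k \<inter> {0..T} = C k" using C(2)[of k] by (auto simp: A_def)
        have "measure lebesgue (C k \<union> (A k - C k)) \<le> measure lebesgue (C k) + measure lebesgue (A k - C k)"
          using Cs[of k] C(3)[of k] by (intro measure_Un_le) auto
        then show ?thesis using C(4)[of k] AC by (simp add: m_def)
      qed
      then show ?thesis using c0 by (intro add_right_mono mult_right_mono sum_mono) auto
    qed
    also have "\<dots> = u T + G * r + G * T / real n"
      using n by (simp add: u_def c_def sum.distrib algebra_simps)
    also have "\<dots> \<le> u T + e" using r(2) n(2) by linarith
    finally show "(LINT t|lebesgue_on {0..T}. g t) - e \<le> u T" by simp
  qed
qed

subsection \<open>Square-integrable functions and the excess\<close>

definition square_integrable :: "'a measure \<Rightarrow> ('a \<Rightarrow> real) \<Rightarrow> bool" where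
  "square_integrable M f \<longleftrightarrow> f \<in> borel_measurable M \<and> integrable M (\<lambda>x. (f x)\<^sup>2)"

lemma square_integrableD:
  assumes "square_integrable M f"
  shows "f \<in> borel_measurable M" "integrable M (\<lambda>x. (f x)\<^sup>2)"
  using assms by (auto simp: square_integrable_def)

lemma power2_add_le: "((x::real) + y)\<^sup>2 \<le> 2 * x\<^sup>2 + 2 * y\<^sup>2"
  using sum_squares_ge_zero[of "x - y" 0] by (simp add: power2_eq_square algebra_simps)

lemma power2_diff_le: "((x::real) - y)\<^sup>2 \<le> 2 * x\<^sup>2 + 2 * y\<^sup>2"
  using power2_add_le[of x "- y"] by simp

lemma mult_le_weighted_squares:
  assumes "c > 0"
  shows "2 * (x * y) \<le> c * x\<^sup>2 + (1 / c) * (y::real)\<^sup>2"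
proof -
  have "0 \<le> (c * x - y)\<^sup>2 / c" using assms by simp
  also have "\<dots> = c * x\<^sup>2 + (1 / c) * y\<^sup>2 - 2 * (x * y)"
    using assms by (simp add: power2_diff diff_divide_distrib add_divide_distrib power_mult_distrib)
      (simp add: power2_eq_square)
  finally show ?thesis by simp
qed

lemma square_integrable_bound:
  assumes "square_integrable M f" "g \<in> borel_measurable M" "AE x in M. \<bar>g x\<bar> \<le> \<bar>f x\<bar>"
  shows "square_integrable M g"
  unfolding square_integrable_def
proof
  show "integrable M (\<lambda>x. (g x)\<^sup>2)"
  proof (rule Bochner_Integration.integrable_bound[OF square_integrableD(2)[OF assms(1)]])
    show "(\<lambda>x. (g x)\<^sup>2) \<in> borel_measurable M" using assms(2) by measurable
    show "AE x in M. norm ((g x)\<^sup>2) \<le> norm ((f x)\<^sup>2)"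
      using assms(3)
    proof eventually_elim
      case (elim x)
      then show ?case using power_mono[of "\<bar>g x\<bar>" "\<bar>f x\<bar>" 2] by simp
    qed
  qed
qed fact

lemma square_integrable_add:
  assumes f: "square_integrable M f" and g: "square_integrable M g"
  shows "square_integrable M (\<lambda>x. f x + g x)"
  unfolding square_integrable_def
proof
  note [measurable] = square_integrableD(1)[OF f] square_integrableD(1)[OF g]
  show "(\<lambda>x. f x + g x) \<in> borel_measurable M" by measurable
  have "integrable M (\<lambda>x. 2 * (f x)\<^sup>2 + 2 * (g x)\<^sup>2)" using f g by (simp add: square_integrableD(2))
  then show "integrable M (\<lambda>x. (f x + g x)\<^sup>2)"
  proof (rule Bochner_Integration.integrable_bound)
    show "AE x in M. norm ((f x + g x)\<^sup>2) \<le> norm (2 * (f x)\<^sup>2 + 2 * (g x)\<^sup>2)"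
    proof (rule AE_I2)
      fix x
      show "norm ((f x + g x)\<^sup>2) \<le> norm (2 * (f x)\<^sup>2 + 2 * (g x)\<^sup>2)"
        using power2_add_le[of "f x" "g x"] by simp
    qed
  qed measurable
qed

lemma square_integrable_cmult:
  "square_integrable M f \<Longrightarrow> square_integrable M (\<lambda>x. c * f x)"
  by (auto simp: square_integrable_def power_mult_distrib)

lemma square_integrable_diff:
  "square_integrable M f \<Longrightarrow> square_integrable M g \<Longrightarrow> square_integrable M (\<lambda>x. f x - g x)"
  using square_integrable_add[of M f "\<lambda>x. -1 * g x"] square_integrable_cmult[of M g "-1"] by simp

lemma (in finite_measure) square_integrable_const: "square_integrable M (\<lambda>x. c)"
  by (simp add: square_integrable_def)

lemma square_integrable_pos_part:
  assumes "square_integrable M f" shows "square_integrable M (\<lambda>x. max 0 (f x))"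
proof (rule square_integrable_bound[OF assms])
  note [measurable] = square_integrableD(1)[OF assms]
  show "(\<lambda>x. max 0 (f x)) \<in> borel_measurable M" by measurable
qed auto

lemma integrable_mult_square_integrable:
  assumes f: "square_integrable M f" and g: "square_integrable M g"
  shows "integrable M (\<lambda>x. f x * g x)"
proof -
  note [measurable] = square_integrableD(1)[OF f] square_integrableD(1)[OF g]
  have "integrable M (\<lambda>x. (f x)\<^sup>2 + (g x)\<^sup>2)" using f g by (simp add: square_integrableD(2))
  then show ?thesis
  proof (rule Bochner_Integration.integrable_bound)
    show "AE x in M. norm (f x * g x) \<le> norm ((f x)\<^sup>2 + (g x)\<^sup>2)"
    proof (rule AE_I2)
      fix x
      have "2 * (\<bar>f x\<bar> * \<bar>g x\<bar>) \<le> (f x)\<^sup>2 + (g x)\<^sup>2"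
        using mult_le_weighted_squares[of 1 "\<bar>f x\<bar>" "\<bar>g x\<bar>"] by simp
      moreover have "0 \<le> \<bar>f x\<bar> * \<bar>g x\<bar>" by simp
      ultimately have "\<bar>f x\<bar> * \<bar>g x\<bar> \<le> (f x)\<^sup>2 + (g x)\<^sup>2" by linarith
      then show "norm (f x * g x) \<le> norm ((f x)\<^sup>2 + (g x)\<^sup>2)"
        by (simp add: abs_mult)
    qed
  qed simp
qed

text \<open>Young's inequality with a free weight takes the place of Cauchy-Schwarz: no square root
  of \<open>E\<close> appears, so the estimates stay linear in \<open>E\<close>. The weight is later
  a time step or a small multiple of the admissible error.\<close>

lemma integral_mult_le_weighted:
  assumes "square_integrable M f" "square_integrable M g" "c > 0"
  shows "2 * (\<integral>x. f x * g x \<partial>M) \<le> c * (\<integral>x. (f x)\<^sup>2 \<partial>M) + (1 / c) * (\<integral>x. (g x)\<^sup>2 \<partial>M)"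
proof -
  have "(\<integral>x. 2 * (f x * g x) \<partial>M) \<le> (\<integral>x. c * (f x)\<^sup>2 + (1 / c) * (g x)\<^sup>2 \<partial>M)"
    using assms integrable_mult_square_integrable[OF assms(1,2)]
    by (intro integral_mono mult_le_weighted_squares Bochner_Integration.integrable_add
        integrable_mult_right) (auto simp: square_integrableD(2))
  then show ?thesis using assms by (simp add: square_integrableD(2))
qed

section \<open>The excess on the square of a probability space\<close>

context prob_space
begin

interpretation P: pair_prob_space M M ..

lemma integral_comp_fst:
  assumes "f \<in> borel_measurable M"
  shows "(\<integral>z. f (fst z) \<partial>(M \<Otimes>\<^sub>M M)) = (\<integral>x. f x \<partial>M :: real)"
    "integrable (M \<Otimes>\<^sub>M M) (\<lambda>z. f (fst z)) \<longleftrightarrow> integrable M f"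
  using assms integral_distr[of fst "M \<Otimes>\<^sub>M M" M f] integrable_distr_eq[of fst "M \<Otimes>\<^sub>M M" M f]
  by (auto simp: distr_pair_fst)

lemma integral_comp_snd:
  assumes "f \<in> borel_measurable M"
  shows "(\<integral>z. f (snd z) \<partial>(M \<Otimes>\<^sub>M M)) = (\<integral>x. f x \<partial>M :: real)"
    "integrable (M \<Otimes>\<^sub>M M) (\<lambda>z. f (snd z)) \<longleftrightarrow> integrable M f"
proof -
  have eq: "M \<Otimes>\<^sub>M M = distr (M \<Otimes>\<^sub>M M) (M \<Otimes>\<^sub>M M) (\<lambda>(x, y). (y, x))"
    by (rule P.distr_pair_swap)
  have "distr (M \<Otimes>\<^sub>M M) M snd = distr (M \<Otimes>\<^sub>M M) M fst"
    by (subst eq, subst distr_distr) (auto simp: comp_def case_prod_beta measurable_pair_swap')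
  then have "distr (M \<Otimes>\<^sub>M M) M snd = M" by (simp add: distr_pair_fst)
  then show "(\<integral>z. f (snd z) \<partial>(M \<Otimes>\<^sub>M M)) = (\<integral>x. f x \<partial>M :: real)"
    "integrable (M \<Otimes>\<^sub>M M) (\<lambda>z. f (snd z)) \<longleftrightarrow> integrable M f"
    using assms integral_distr[of snd "M \<Otimes>\<^sub>M M" M f] integrable_distr_eq[of snd "M \<Otimes>\<^sub>M M" M f]
    by auto
qed

lemma square_integrable_comp_fst:
  "square_integrable M f \<Longrightarrow> square_integrable (M \<Otimes>\<^sub>M M) (\<lambda>z. f (fst z))"
  using integral_comp_fst(2)[of "\<lambda>x. (f x)\<^sup>2"] by (auto simp: square_integrable_def)

lemma square_integrable_comp_snd:
  "square_integrable M f \<Longrightarrow> square_integrable (M \<Otimes>\<^sub>M M) (\<lambda>z. f (snd z))"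
  using integral_comp_snd(2)[of "\<lambda>x. (f x)\<^sup>2"] by (auto simp: square_integrable_def)

lemma square_integrable_pair_diff:
  assumes "square_integrable M f"
  shows "square_integrable (M \<Otimes>\<^sub>M M) (\<lambda>z. f (fst z) - f (snd z))"
  by (intro square_integrable_diff square_integrable_comp_fst square_integrable_comp_snd assms)

lemma integral_pair_diff_sq_le:
  assumes "square_integrable M f"
  shows "(\<integral>z. (f (fst z) - f (snd z))\<^sup>2 \<partial>(M \<Otimes>\<^sub>M M)) \<le> 4 * (\<integral>x. (f x)\<^sup>2 \<partial>M)"
proof -
  have m: "(\<lambda>x. (f x)\<^sup>2) \<in> borel_measurable M"
    by (rule borel_measurable_integrable[OF square_integrableD(2)[OF assms]])
  have "(\<integral>z. (f (fst z) - f (snd z))\<^sup>2 \<partial>(M \<Otimes>\<^sub>M M))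
      \<le> (\<integral>z. 2 * (f (fst z))\<^sup>2 + 2 * (f (snd z))\<^sup>2 \<partial>(M \<Otimes>\<^sub>M M))"
    using square_integrable_pair_diff[OF assms] square_integrable_comp_fst[OF assms]
      square_integrable_comp_snd[OF assms]
    by (intro integral_mono power2_diff_le) (simp_all add: square_integrableD(2))
  also have "\<dots> = 2 * (\<integral>x. (f x)\<^sup>2 \<partial>M) + 2 * (\<integral>x. (f x)\<^sup>2 \<partial>M)"
    using square_integrable_comp_fst[OF assms] square_integrable_comp_snd[OF assms]
    by (subst Bochner_Integration.integral_add)
      (simp_all add: integral_comp_fst(1)[OF m] integral_comp_snd(1)[OF m] square_integrableD(2))
  finally show ?thesis by simp
qed

text \<open>\<open>p i j\<close> is the excess of \<open>w i - w j\<close> over \<open>d\<close>. Where it is positive, \<open>w k - w i \<le> p k j\<close> and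
  \<open>w j - w k \<le> p i k\<close>: up to the excesses, \<open>i\<close> and \<open>j\<close> are extremal.\<close>

lemma excess_production_le:
  fixes w V :: "'a \<Rightarrow> real" and K :: "'a \<Rightarrow> 'a \<Rightarrow> real"
  defines "p \<equiv> \<lambda>d i j. max 0 (w i - w j - d)"
  assumes w: "square_integrable M w" and V: "square_integrable M V"
    and Km: "case_prod K \<in> borel_measurable (M \<Otimes>\<^sub>M M)"
    and K: "\<And>i k. i \<in> space M \<Longrightarrow> k \<in> space M \<Longrightarrow> 0 \<le> K i k \<and> K i k \<le> \<Phi>"
    and eq: "AE i in M. V i = (\<integral>k. K i k * (w k - w i) \<partial>M)"
    and g: "AE i in M. AE j in M. g \<le> (\<integral>k. min (K i k) (K j k) \<partial>M)"
    and d0: "0 \<le> d" and g0: "0 \<le> g"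
  shows "(\<integral>z. p d (fst z) (snd z) * (V (fst z) - V (snd z) + g * d) \<partial>(M \<Otimes>\<^sub>M M))
      \<le> 2 * \<Phi> * (\<integral>z. (p d (fst z) (snd z))\<^sup>2 \<partial>(M \<Otimes>\<^sub>M M))" (is "?l \<le> _")
proof -
  note [measurable] = square_integrableD(1)[OF w] square_integrableD(1)[OF V] Km
  define q where "q = p d"
  obtain i0 where "i0 \<in> space M" using not_empty by auto
  then have \<Phi>0: "0 \<le> \<Phi>" using K[of i0 i0] by auto
  have q0: "0 \<le> q i j" for i j by (simp add: q_def p_def)
  have qP: "square_integrable (M \<Otimes>\<^sub>M M) (\<lambda>z. q (fst z) (snd z))"
    unfolding q_def p_def
    by (intro square_integrable_pos_part square_integrable_diff square_integrable_pair_diff[OF w, simplified]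
        P.square_integrable_const square_integrable_comp_fst square_integrable_comp_snd w)
  have q1: "square_integrable M (\<lambda>k. q k j)" and q2: "square_integrable M (\<lambda>k. q i k)" for i j
    unfolding q_def p_def
    by (intro square_integrable_pos_part square_integrable_diff square_integrable_const w)+
  \<comment> \<open>Marginals of the squared excess. They collect the contributions of the pairs (k,
    j) and (i, k), and each integrates back to the full double integral.\<close>
  define S1 where "S1 j = (\<integral>k. (q k j)\<^sup>2 \<partial>M)" for j
  define S2 where "S2 i = (\<integral>k. (q i k)\<^sup>2 \<partial>M)" for i
  have S0: "0 \<le> S1 j" "0 \<le> S2 j" for j by (simp_all add: S1_def S2_def)
  have int: "integrable M f" if "square_integrable M f" for f
    using square_integrable_imp_integrable square_integrableD that by blast
  have KI: "integrable M (\<lambda>k. K i k * (w k - w i))" if "i \<in> space M" for i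
  proof (rule Bochner_Integration.integrable_bound)
    show "integrable M (\<lambda>k. \<Phi> * (w k - w i))" using int[OF w] by simp
    show "AE k in M. norm (K i k * (w k - w i)) \<le> norm (\<Phi> * (w k - w i))"
      using K[OF that] \<Phi>0 by (intro AE_I2) (auto simp: abs_mult intro!: mult_right_mono)
  qed (use that in measurable)
  have KM: "integrable M (\<lambda>k. min (K i k) (K j k))" if "i \<in> space M" "j \<in> space M" for i j
    using K that by (intro integrable_const_bound[of _ \<Phi>] AE_I2) (auto simp: min_def)
  have bound: "q i j * (V i - V j + g * d) \<le> \<Phi> * ((q i j)\<^sup>2 + S1 j / 2 + S2 i / 2)"
    if ij: "i \<in> space M" "j \<in> space M"
      and Vi: "V i = (\<integral>k. K i k * (w k - w i) \<partial>M)" and Vj: "V j = (\<integral>k. K j k * (w k - w j) \<partial>M)"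
      and gij: "g \<le> (\<integral>k. min (K i k) (K j k) \<partial>M)" for i j
  proof (cases "q i j = 0")
    case True
    then show ?thesis using S0 \<Phi>0 by simp
  next
    case False
    then have qij: "q i j = w i - w j - d" "0 < q i j" by (auto simp: q_def p_def max_def split: if_splits)
    have *: "K i k * (w k - w i) - K j k * (w k - w j)
        \<le> \<Phi> * (q k j + q i k) - min (K i k) (K j k) * d" if k: "k \<in> space M" for k
    proof -
      have b: "w i - w k + q k j \<ge> 0" "w k - w j + q i k \<ge> 0"
        using qij by (auto simp: q_def p_def max_def)
      \<comment> \<open>The two brackets sum to \<open>w i - w j + q k j + q i k\<close>, which is
        at least \<open>d\<close>. Since each of them is nonnegative after adding its excess, the
        common weight \<open>min\<close> may next be raised to \<open>K i k\<close> in the first and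
        to \<open>K j k\<close> in the second.\<close>
      have "min (K i k) (K j k) * d \<le> min (K i k) (K j k) * ((w i - w k + q k j) + (w k - w j + q i k))"
        using K[OF ij(1) k] K[OF ij(2) k] qij q0[of k j] q0[of i k] by (intro mult_left_mono) auto
      also have "\<dots> \<le> K i k * (w i - w k + q k j) + K j k * (w k - w j + q i k)"
        using b distrib_left[of "min (K i k) (K j k)" "w i - w k + q k j" "w k - w j + q i k"]
        by (metis add_mono min.cobounded1 min.cobounded2 mult_right_mono)
      also have "\<dots> = - (K i k * (w k - w i) - K j k * (w k - w j)) + (K i k * q k j + K j k * q i k)"
        by (simp add: algebra_simps)
      also have "K i k * q k j + K j k * q i k \<le> \<Phi> * q k j + \<Phi> * q i k"
        using K[OF ij(1) k] K[OF ij(2) k] q0 by (intro add_mono mult_right_mono) auto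
      finally show ?thesis by (simp add: algebra_simps)
    qed
    have "V i - V j = (\<integral>k. K i k * (w k - w i) - K j k * (w k - w j) \<partial>M)"
      unfolding Vi Vj using KI ij by simp
    also have "\<dots> \<le> (\<integral>k. \<Phi> * (q k j + q i k) - min (K i k) (K j k) * d \<partial>M)"
      using KI KM ij int[OF q1] int[OF q2] * by (intro integral_mono) auto
    also have "\<dots> = \<Phi> * (\<integral>k. q k j + q i k \<partial>M) - (\<integral>k. min (K i k) (K j k) \<partial>M) * d"
      using KM[OF ij] int[OF q1] int[OF q2] by (subst Bochner_Integration.integral_diff) auto
    also have "\<dots> \<le> \<Phi> * (\<integral>k. q k j + q i k \<partial>M) - g * d"
      using gij d0 by (simp add: mult_right_mono)
    finally have "V i - V j + g * d \<le> \<Phi> * (\<integral>k. q k j + q i k \<partial>M)" by simp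
    then have "q i j * (V i - V j + g * d) \<le> q i j * (\<Phi> * (\<integral>k. q k j + q i k \<partial>M))"
      using q0 by (rule mult_left_mono)
    also have "\<dots> = \<Phi> * (\<integral>k. q i j * (q k j + q i k) \<partial>M)" by simp
    \<comment> \<open>Each product of two excesses is split evenly into squares. After integration
      over \<open>i\<close> and \<open>j\<close> the coefficients 1, 1/2 and 1/2 all multiply the
      same double integral, which is the origin of the factor 2 in the conclusion.\<close>
    also have "\<dots> \<le> \<Phi> * (\<integral>k. (q i j)\<^sup>2 + (q k j)\<^sup>2 / 2 + (q i k)\<^sup>2 / 2 \<partial>M)"
    proof (intro mult_left_mono integral_mono \<Phi>0)
      show "integrable M (\<lambda>k. q i j * (q k j + q i k))" using int[OF q1] int[OF q2] by auto
      show "integrable M (\<lambda>k. (q i j)\<^sup>2 + (q k j)\<^sup>2 / 2 + (q i k)\<^sup>2 / 2)"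
        using square_integrableD(2)[OF q1] square_integrableD(2)[OF q2]
        by (intro Bochner_Integration.integrable_add integrable_divide) auto
      show "q i j * (q k j + q i k) \<le> (q i j)\<^sup>2 + (q k j)\<^sup>2 / 2 + (q i k)\<^sup>2 / 2" for k
        using mult_le_weighted_squares[of 1 "q i j" "q k j"] mult_le_weighted_squares[of 1 "q i j" "q i k"]
        by (simp add: distrib_left)
    qed
    also have "(\<integral>k. (q i j)\<^sup>2 + (q k j)\<^sup>2 / 2 + (q i k)\<^sup>2 / 2 \<partial>M) = (q i j)\<^sup>2 + S1 j / 2 + S2 i / 2"
      using square_integrableD(2)[OF q1] square_integrableD(2)[OF q2] 
      by (simp add: S1_def S2_def prob_space)
    finally show ?thesis .
  qed
  have sq: "integrable (M \<Otimes>\<^sub>M M) (\<lambda>(i, j). (q i j)\<^sup>2)"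
    using square_integrableD(2)[OF qP] by (simp add: case_prod_beta')
  have S1i: "integrable M S1" and S1e: "integral\<^sup>L M S1 = (\<integral>z. (q (fst z) (snd z))\<^sup>2 \<partial>(M \<Otimes>\<^sub>M M))"
    using P.integrable_snd[OF sq] P.integral_snd[OF sq] by (simp_all add: S1_def[abs_def] case_prod_beta')
  have S2i: "integrable M S2" and S2e: "integral\<^sup>L M S2 = (\<integral>z. (q (fst z) (snd z))\<^sup>2 \<partial>(M \<Otimes>\<^sub>M M))"
    using P.integrable_fst[OF sq] P.integral_fst[OF sq] by (simp_all add: S2_def[abs_def] case_prod_beta')
  have S1m: "S1 \<in> borel_measurable M" and S2m: "S2 \<in> borel_measurable M" using S1i S2i by auto
  have "?l \<le> (\<integral>z. \<Phi> * ((q (fst z) (snd z))\<^sup>2 + S1 (snd z) / 2 + S2 (fst z) / 2) \<partial>(M \<Otimes>\<^sub>M M))"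
    unfolding q_def[symmetric]
  proof (rule integral_mono_AE)
    show "integrable (M \<Otimes>\<^sub>M M) (\<lambda>z. q (fst z) (snd z) * (V (fst z) - V (snd z) + g * d))"
      by (intro integrable_mult_square_integrable qP square_integrable_add square_integrable_pair_diff V
          P.square_integrable_const)
    show "integrable (M \<Otimes>\<^sub>M M) (\<lambda>z. \<Phi> * ((q (fst z) (snd z))\<^sup>2 + S1 (snd z) / 2 + S2 (fst z) / 2))"
      using square_integrableD(2)[OF qP] S1i S2i integral_comp_fst(2)[OF S2m] integral_comp_snd(2)[OF S1m]
      by auto
    define Q where "Q z \<longleftrightarrow> q (fst z) (snd z) * (V (fst z) - V (snd z) + g * d)
        \<le> \<Phi> * ((q (fst z) (snd z))\<^sup>2 + S1 (snd z) / 2 + S2 (fst z) / 2)" for z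
    have "AE i in M. AE j in M. Q (i, j)"
      using AE_space eq g
    proof eventually_elim
      case (elim i)
      note i = elim
      show ?case using AE_space eq i(3)
      proof eventually_elim
        case (elim j)
        then show ?case using bound[OF i(1) elim(1) i(2) elim(2)] by (simp add: Q_def)
      qed
    qed
    moreover have "{z \<in> space (M \<Otimes>\<^sub>M M). Q z} \<in> sets (M \<Otimes>\<^sub>M M)"
      unfolding Q_def using S1m S2m square_integrableD(1)[OF qP] by measurable
    ultimately have "AE z in M \<Otimes>\<^sub>M M. Q z" by (intro P.AE_pair_measure)
    then show "AE z in M \<Otimes>\<^sub>M M. q (fst z) (snd z) * (V (fst z) - V (snd z) + g * d)
        \<le> \<Phi> * ((q (fst z) (snd z))\<^sup>2 + S1 (snd z) / 2 + S2 (fst z) / 2)" by (simp add: Q_def)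
  qed
  also have "\<dots> = \<Phi> * ((\<integral>z. (q (fst z) (snd z))\<^sup>2 \<partial>(M \<Otimes>\<^sub>M M)) + (\<integral>z. S1 (snd z) \<partial>(M \<Otimes>\<^sub>M M)) / 2
      + (\<integral>z. S2 (fst z) \<partial>(M \<Otimes>\<^sub>M M)) / 2)"
    using square_integrableD(2)[OF qP] S1i S2i integral_comp_fst(2)[OF S2m] integral_comp_snd(2)[OF S1m]
    by simp
  also have "\<dots> = 2 * \<Phi> * (\<integral>z. (q (fst z) (snd z))\<^sup>2 \<partial>(M \<Otimes>\<^sub>M M))"
    by (simp add: integral_comp_fst(1)[OF S2m] integral_comp_snd(1)[OF S1m] S1e S2e)
  finally show ?thesis by (simp add: q_def)
qed

end

text \<open>The function \<open>(max 0 s)\<^sup>2\<close> has derivative \<open>2 * max 0 s\<close>,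
  which is Lipschitz with constant 2; this is the resulting Taylor bound at \<open>a\<close>. Being
  an inequality without exceptional points, it can be integrated over pairs directly.\<close>

lemma pos_part_square_le:
  "(max 0 b)\<^sup>2 \<le> (max 0 a)\<^sup>2 + 2 * (max 0 a * (b - a)) + ((b::real) - a)\<^sup>2"
proof (cases "a \<le> 0")
  case True
  then have "(max 0 b)\<^sup>2 \<le> (b - a)\<^sup>2"
    by (cases "b \<le> 0") (simp_all add: power_mono)
  with True show ?thesis by simp
next
  case False
  have "(max 0 b)\<^sup>2 \<le> b\<^sup>2" by (cases "b \<le> 0") auto
  also have "b\<^sup>2 = a\<^sup>2 + 2 * (a * (b - a)) + (b - a)\<^sup>2"
    by (simp add: power2_eq_square algebra_simps)
  finally show ?thesis using False by simp
qed

context prob_space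
begin

interpretation P: pair_prob_space M M ..

text \<open>Gronwall's inequality for the squared \<open>L\<^sup>2\<close> norm \<open>E\<close> of the excess of \<open>w t i - w t j\<close> over \<open>d t\<close>.\<close>

lemma spread_le_barrier:
  fixes w :: "real \<Rightarrow> 'a \<Rightarrow> real" and d g :: "real \<Rightarrow> real"
  assumes T: "0 \<le> T"
    and w: "\<And>t. 0 \<le> t \<Longrightarrow> square_integrable M (w t)"
    and lip: "\<And>t. 0 \<le> t \<Longrightarrow> \<exists>u>0. \<exists>L. \<forall>r\<in>cball t u \<inter> {0..}. \<forall>s\<in>cball t u \<inter> {0..}.
      (\<integral>i. (w r i - w s i)\<^sup>2 \<partial>M) \<le> L * (r - s)\<^sup>2"
    and d0: "\<And>t. 0 \<le> t \<Longrightarrow> 0 \<le> d t"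
    and dlip: "\<And>r s. 0 \<le> r \<Longrightarrow> 0 \<le> s \<Longrightarrow> \<bar>d s - d r\<bar> \<le> D * \<bar>s - r\<bar>"
    and dstep: "\<And>t. t \<in> {0..<T} \<Longrightarrow> \<forall>\<^sub>F s in at_right t. - (g t * d t * (s - t)) \<le> d s - d t"
    and g0: "\<And>t. t \<in> {0..<T} \<Longrightarrow> 0 \<le> g t"
    and ae: "AE t in lebesgue. t \<in> {0..<T} \<longrightarrow> (\<exists>K V. square_integrable M V \<and>
      case_prod K \<in> borel_measurable (M \<Otimes>\<^sub>M M) \<and>
      (\<forall>i\<in>space M. \<forall>k\<in>space M. 0 \<le> K i k \<and> K i k \<le> \<Phi>) \<and>
      (AE i in M. V i = (\<integral>k. K i k * (w t k - w t i) \<partial>M)) \<and>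
      (AE i in M. AE j in M. g t \<le> (\<integral>k. min (K i k) (K j k) \<partial>M)) \<and>
      ((\<lambda>s. \<integral>i. ((w s i - w t i) / (s - t) - V i)\<^sup>2 \<partial>M) \<longlongrightarrow> 0) (at_right t))"
    and init: "AE i in M. AE j in M. w 0 i - w 0 j \<le> d 0"
  shows "AE i in M. AE j in M. w T i - w T j \<le> d T"
proof -
  define q where "q t z = w t (fst z) - w t (snd z) - d t" for t z
  define p where "p t z = max 0 (q t z)" for t z
  define E where "E t = (\<integral>z. (p t z)\<^sup>2 \<partial>(M \<Otimes>\<^sub>M M))" for t
  have q: "square_integrable (M \<Otimes>\<^sub>M M) (q t)" if "0 \<le> t" for t
    unfolding q_def[abs_def]
    by (intro square_integrable_diff[OF square_integrable_pair_diff] w that P.square_integrable_const)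
  have p: "square_integrable (M \<Otimes>\<^sub>M M) (p t)" if "0 \<le> t" for t
    unfolding p_def[abs_def] by (intro square_integrable_pos_part q that)
  have E0: "0 \<le> E t" for t by (simp add: E_def)
  have expand: "E s \<le> E t + 2 * (\<integral>z. p t z * (q s z - q t z) \<partial>(M \<Otimes>\<^sub>M M))
      + (\<integral>z. (q s z - q t z)\<^sup>2 \<partial>(M \<Otimes>\<^sub>M M))" if "0 \<le> s" "0 \<le> t" for s t
  proof -
    note dq = square_integrable_diff[OF q[OF that(1)] q[OF that(2)]]
    note i1 = square_integrableD(2)[OF p[OF that(2)]] square_integrableD(2)[OF p[OF that(1)]]
      integrable_mult_square_integrable[OF p[OF that(2)] dq] square_integrableD(2)[OF dq]
    have "E s \<le> (\<integral>z. (p t z)\<^sup>2 + 2 * (p t z * (q s z - q t z)) + (q s z - q t z)\<^sup>2 \<partial>(M \<Otimes>\<^sub>M M))"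
      unfolding E_def
    proof (rule integral_mono)
      show "(p s z)\<^sup>2 \<le> (p t z)\<^sup>2 + 2 * (p t z * (q s z - q t z)) + (q s z - q t z)\<^sup>2" for z
        unfolding p_def by (rule pos_part_square_le)
    qed (use i1 in simp_all)
    then show ?thesis using i1 by (simp add: E_def)
  qed
  have qdiff: "(\<integral>z. (q s z - q t z)\<^sup>2 \<partial>(M \<Otimes>\<^sub>M M)) \<le> (8 * L + 2 * D\<^sup>2) * (s - t)\<^sup>2"
    if st: "0 \<le> s" "0 \<le> t" and L: "(\<integral>i. (w s i - w t i)\<^sup>2 \<partial>M) \<le> L * (s - t)\<^sup>2" for s t L
  proof -
    have \<Delta>: "square_integrable M (\<lambda>i. w s i - w t i)"
      by (rule square_integrable_diff[OF w[OF st(1)] w[OF st(2)]])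
    note \<Delta>2 = square_integrableD(2)[OF square_integrable_pair_diff[OF \<Delta>]]
    have "(\<integral>z. (q s z - q t z)\<^sup>2 \<partial>(M \<Otimes>\<^sub>M M)) \<le>
      (\<integral>z. 2 * ((w s (fst z) - w t (fst z)) - (w s (snd z) - w t (snd z)))\<^sup>2 + 2 * (d s - d t)\<^sup>2 \<partial>(M \<Otimes>\<^sub>M M))"
    proof (rule integral_mono)
      show "integrable (M \<Otimes>\<^sub>M M) (\<lambda>z. (q s z - q t z)\<^sup>2)"
        by (rule square_integrableD(2)[OF square_integrable_diff[OF q[OF st(1)] q[OF st(2)]]])
      show "integrable (M \<Otimes>\<^sub>M M) (\<lambda>z. 2 * ((w s (fst z) - w t (fst z)) - (w s (snd z) - w t (snd z)))\<^sup>2 + 2 * (d s - d t)\<^sup>2)"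
        using \<Delta>2 by simp
      show "(q s z - q t z)\<^sup>2 \<le> 2 * ((w s (fst z) - w t (fst z)) - (w s (snd z) - w t (snd z)))\<^sup>2 + 2 * (d s - d t)\<^sup>2" for z
        using power2_diff_le[of "(w s (fst z) - w t (fst z)) - (w s (snd z) - w t (snd z))" "d s - d t"]
        by (simp add: q_def algebra_simps)
    qed
    also have "\<dots> = 2 * (\<integral>z. ((w s (fst z) - w t (fst z)) - (w s (snd z) - w t (snd z)))\<^sup>2 \<partial>(M \<Otimes>\<^sub>M M)) + 2 * (d s - d t)\<^sup>2"
      using \<Delta>2 by (simp add: P.prob_space)
    also have "\<dots> \<le> 2 * (4 * (L * (s - t)\<^sup>2)) + 2 * (D\<^sup>2 * (s - t)\<^sup>2)"
    proof -
      have "\<bar>d s - d t\<bar>\<^sup>2 \<le> (D * \<bar>s - t\<bar>)\<^sup>2" using dlip[OF st(2,1)] by (intro power_mono) auto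
      then have "(d s - d t)\<^sup>2 \<le> D\<^sup>2 * (s - t)\<^sup>2" by (simp add: power_mult_distrib)
      then show ?thesis using integral_pair_diff_sq_le[OF \<Delta>] L by linarith
    qed
    finally show ?thesis by (simp add: algebra_simps)
  qed
  \<comment> \<open>The weight in Young's inequality is the step \<open>\<bar>s - t\<bar>\<close>
    itself: it makes the \<open>E t\<close> term first order, while its reciprocal turns the
    second-order bound on the increment of \<open>q\<close> into a first-order one.\<close>
  have incr: "E s - E t \<le> \<bar>s - t\<bar> * (E t + Q + Q * \<bar>s - t\<bar>)"
    if st: "0 \<le> s" "0 \<le> t" and L: "(\<integral>i. (w s i - w t i)\<^sup>2 \<partial>M) \<le> L * (s - t)\<^sup>2"
      and Q: "Q = 8 * L + 2 * D\<^sup>2" for s t L Q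
  proof (cases "s = t")
    case False
    then have h: "\<bar>s - t\<bar> > 0" by simp
    note qd = qdiff[OF st L, folded Q]
    have "2 * (\<integral>z. p t z * (q s z - q t z) \<partial>(M \<Otimes>\<^sub>M M))
        \<le> \<bar>s - t\<bar> * E t + (1 / \<bar>s - t\<bar>) * (\<integral>z. (q s z - q t z)\<^sup>2 \<partial>(M \<Otimes>\<^sub>M M))"
      unfolding E_def by (intro integral_mult_le_weighted square_integrable_diff p q st h)
    also have "(1 / \<bar>s - t\<bar>) * (\<integral>z. (q s z - q t z)\<^sup>2 \<partial>(M \<Otimes>\<^sub>M M)) \<le> (1 / \<bar>s - t\<bar>) * (Q * \<bar>s - t\<bar>\<^sup>2)"
      using qd by (intro mult_left_mono) auto
    also have "(1 / \<bar>s - t\<bar>) * (Q * \<bar>s - t\<bar>\<^sup>2) = Q * \<bar>s - t\<bar>"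
    proof -
      have "(1 / y) * (Q * y\<^sup>2) = Q * y" if "0 < y" for y :: real
        using that by (simp add: power2_eq_square)
      then show ?thesis using h by blast
    qed
    finally have "E s - E t \<le> \<bar>s - t\<bar> * E t + Q * \<bar>s - t\<bar> + Q * (s - t)\<^sup>2"
      using expand[OF st] qd by linarith
    also have "\<dots> = \<bar>s - t\<bar> * (E t + Q + Q * \<bar>s - t\<bar>)"
    proof -
      have "(s - t)\<^sup>2 = \<bar>s - t\<bar> * \<bar>s - t\<bar>" by (simp add: power2_eq_square)
      then show ?thesis by (simp only: distrib_left mult_ac add_ac)
    qed
    finally show ?thesis .
  qed simp
  \<comment> \<open>\<open>incr\<close> has \<open>E t\<close> in its Lipschitz factor, so
    \<open>E\<close> is first bounded near each time by comparison with the centre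
    \<open>t0\<close>. The local constants are then combined by compactness of
    \<open>[0, T]\<close>; the set \<open>{0}\<close> is a dummy parameter space. A global constant
    is what \<open>ae_nonincreasing\<close> asks for at the exceptional times.\<close>
  have "local_lipschitz {0 :: real} {0..T} (\<lambda>_. E)"
  proof (rule local_lipschitzI)
    fix t :: real and t0 assume "t0 \<in> {0..T}"
    then have t0: "0 \<le> t0" by simp
    from lip[OF t0] obtain u L where u: "u > 0" and L: "\<And>r s. r \<in> cball t0 u \<inter> {0..} \<Longrightarrow> s \<in> cball t0 u \<inter> {0..} \<Longrightarrow>
      (\<integral>i. (w r i - w s i)\<^sup>2 \<partial>M) \<le> L * (r - s)\<^sup>2" by blast
    define L' where "L' = max L 0"
    define Q where "Q = 8 * L' + 2 * D\<^sup>2"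
    have Q0: "0 \<le> Q" by (simp add: Q_def L'_def)
    have L': "(\<integral>i. (w r i - w s i)\<^sup>2 \<partial>M) \<le> L' * (r - s)\<^sup>2" if "r \<in> cball t0 u \<inter> {0..}" "s \<in> cball t0 u \<inter> {0..}" for r s
      using L[OF that] mult_right_mono[of L L' "(r - s)\<^sup>2"] by (simp add: L'_def)
    define v where "v = min u 1"
    define B where "B = E t0 + (E t0 + Q + Q)"
    have EB: "E r \<le> B" if r: "r \<in> cball t0 v \<inter> {0..}" for r
    proof -
      have r': "r \<in> cball t0 u \<inter> {0..}" "\<bar>r - t0\<bar> \<le> 1" "t0 \<in> cball t0 u \<inter> {0..}" "0 \<le> r"
        using r t0 u by (auto simp: v_def dist_real_def)
      have "E r - E t0 \<le> \<bar>r - t0\<bar> * (E t0 + Q + Q * \<bar>r - t0\<bar>)"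
        using incr[OF r'(4) t0 L'[OF r'(1,3)] Q_def] .
      also have "\<dots> \<le> 1 * (E t0 + Q + Q * 1)"
        using r' Q0 E0[of t0] by (intro mult_mono add_mono mult_left_mono) auto
      finally show ?thesis by (simp add: B_def)
    qed
    have one: "E s - E r \<le> (B + 3 * Q) * \<bar>s - r\<bar>"
      if r: "r \<in> cball t0 v \<inter> {0..}" and s: "s \<in> cball t0 v \<inter> {0..}" for r s
    proof -
      have rs: "r \<in> cball t0 u \<inter> {0..}" "s \<in> cball t0 u \<inter> {0..}" "0 \<le> r" "0 \<le> s" "\<bar>s - r\<bar> \<le> 2"
        using r s by (auto simp: v_def dist_real_def)
      have "E s - E r \<le> \<bar>s - r\<bar> * (E r + Q + Q * \<bar>s - r\<bar>)"
        using incr[OF rs(4,3) L'[OF rs(2,1)] Q_def] .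
      also have "\<dots> \<le> \<bar>s - r\<bar> * (B + Q + Q * 2)"
        using rs Q0 EB[OF r] by (intro add_mono mult_left_mono) auto
      finally show ?thesis by (simp add: algebra_simps)
    qed
    have "(B + 3 * Q)-lipschitz_on (cball t0 v \<inter> {0..T}) E"
    proof (rule lipschitz_onI)
      show "0 \<le> B + 3 * Q" using Q0 E0[of t0] by (simp add: B_def)
      fix r s assume "r \<in> cball t0 v \<inter> {0..T}" "s \<in> cball t0 v \<inter> {0..T}"
      then show "dist (E r) (E s) \<le> (B + 3 * Q) * dist r s"
        using one[of r s] one[of s r] by (auto simp: dist_real_def abs_minus_commute)
    qed
    moreover have "v > 0" using u by (simp add: v_def)
    ultimately show "\<exists>u>0. \<exists>L. \<forall>t'\<in>cball t u \<inter> {0}. L-lipschitz_on (cball t0 u \<inter> {0..T}) E" by blast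
  qed
  then obtain N where N: "N-lipschitz_on {0..T} E"
    by (rule local_lipschitz_compact_implies_lipschitz[where X="{0..T}"]) auto
  obtain i0 where "i0 \<in> space M" using not_empty by auto
  \<comment> \<open>A factor 2 comes from differentiating the square and \<open>2 * \<Phi>\<close>
    from \<open>excess_production_le\<close>. The maximum makes \<open>C\<close> nonnegative at
    once: nonnegativity of \<Phi> follows only at a time where a kernel \<open>K\<close> is
    given.\<close>
  define C where "C = 4 * max \<Phi> 0"
  have C0: "0 \<le> C" by (simp add: C_def)
  define F where "F t = exp (- (C * t)) * E t" for t
  \<comment> \<open>Integrating factor in difference form: since
    \<open>1 + C * (s - t) \<le> exp (C * (s - t))\<close>, the discount absorbs the growth
    \<open>C * E t\<close>, and only the error \<open>b\<close> survives.\<close>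
  have Fstep: "F s - F t \<le> b * (s - t)"
    if st: "0 \<le> t" "t < s" and Es: "E s - E t \<le> (C * E t + b) * (s - t)" and b: "0 \<le> b" for s t b
  proof -
    have "exp (- (C * s)) * (1 + C * (s - t)) \<le> exp (- (C * s)) * exp (C * (s - t))"
      by (intro mult_left_mono exp_ge_add_one_self) auto
    also have "\<dots> = exp (- (C * t))" by (simp add: exp_add[symmetric] algebra_simps)
    finally have "exp (- (C * s)) * (1 + C * (s - t)) * E t \<le> exp (- (C * t)) * E t"
      using E0 by (rule mult_right_mono)
    moreover have "exp (- (C * s)) * (E s - E t) \<le> exp (- (C * s)) * ((C * E t + b) * (s - t))"
      using Es by (intro mult_left_mono) auto
    ultimately have "F s - F t \<le> exp (- (C * s)) * (b * (s - t))"
      by (simp add: F_def algebra_simps)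
    also have "\<dots> \<le> 1 * (b * (s - t))"
      using C0 st b by (intro mult_right_mono) auto
    finally show ?thesis by simp
  qed
  have "F T \<le> F 0"
  proof (rule ae_nonincreasing[OF T])
    show "continuous_on {0..T} F"
      unfolding F_def by (intro continuous_intros lipschitz_on_continuous_on[OF N])
    show "\<forall>\<^sub>F s in at_right t. F s - F t \<le> N * (s - t)" if t: "t \<in> {0..<T}" for t
    proof -
      have "\<forall>\<^sub>F s in at_right t. s \<in> {t<..<T}" using t by (intro eventually_at_right_real) auto
      then show ?thesis
      proof eventually_elim
        case (elim s)
        have "dist (E s) (E t) \<le> N * dist s t" using elim t by (intro lipschitz_onD[OF N]) auto
        then have "E s - E t \<le> N * (s - t)" using elim by (simp add: dist_real_def)
        also have "\<dots> \<le> (C * E t + N) * (s - t)"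
          using C0 E0[of t] elim by (intro mult_right_mono) auto
        finally show ?case using elim t lipschitz_on_nonneg[OF N] by (intro Fstep) auto
      qed
    qed
    show "AE t in lebesgue. t \<in> {0..<T} \<longrightarrow> (\<forall>e>0. \<forall>\<^sub>F s in at_right t. F s - F t \<le> e * (s - t))"
      using ae
    proof (eventually_elim, intro impI allI)
      fix t e :: real
      assume *: "t \<in> {0..<T} \<longrightarrow> (\<exists>K V. square_integrable M V \<and>
        case_prod K \<in> borel_measurable (M \<Otimes>\<^sub>M M) \<and>
        (\<forall>i\<in>space M. \<forall>k\<in>space M. 0 \<le> K i k \<and> K i k \<le> \<Phi>) \<and>
        (AE i in M. V i = (\<integral>k. K i k * (w t k - w t i) \<partial>M)) \<and>
        (AE i in M. AE j in M. g t \<le> (\<integral>k. min (K i k) (K j k) \<partial>M)) \<and>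
        ((\<lambda>s. \<integral>i. ((w s i - w t i) / (s - t) - V i)\<^sup>2 \<partial>M) \<longlongrightarrow> 0) (at_right t))"
        and t: "t \<in> {0..<T}" and e: "0 < e"
      from * t obtain K V where V: "square_integrable M V"
        and Km: "case_prod K \<in> borel_measurable (M \<Otimes>\<^sub>M M)"
        and K: "\<And>i k. i \<in> space M \<Longrightarrow> k \<in> space M \<Longrightarrow> 0 \<le> K i k \<and> K i k \<le> \<Phi>"
        and eq: "AE i in M. V i = (\<integral>k. K i k * (w t k - w t i) \<partial>M)"
        and gt: "AE i in M. AE j in M. g t \<le> (\<integral>k. min (K i k) (K j k) \<partial>M)"
        and lim: "((\<lambda>s. \<integral>i. ((w s i - w t i) / (s - t) - V i)\<^sup>2 \<partial>M) \<longlongrightarrow> 0) (at_right t)" by blast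
      have t0: "0 \<le> t" using t by simp
      have \<Phi>: "\<Phi> = max \<Phi> 0" using K[of i0 i0] \<open>i0 \<in> space M\<close> by auto
      have prod: "2 * (\<integral>z. p t z * (V (fst z) - V (snd z) + g t * d t) \<partial>(M \<Otimes>\<^sub>M M)) \<le> C * E t"
        using excess_production_le[OF w[OF t0] V Km K eq gt d0[OF t0] g0[OF t]] \<Phi>
        by (simp add: p_def q_def E_def C_def)
      from lip[OF t0] obtain u L where u: "u > 0" and L: "\<And>r s. r \<in> cball t u \<inter> {0..} \<Longrightarrow> s \<in> cball t u \<inter> {0..} \<Longrightarrow>
        (\<integral>i. (w r i - w s i)\<^sup>2 \<partial>M) \<le> L * (r - s)\<^sup>2" by blast
      \<comment> \<open>The error \<open>e\<close> is spent in thirds: the weight \<open>c\<close>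
        makes \<open>c * E t\<close> one third, the threshold \<open>e * c / 12\<close> for the
        residual gives the second (after the factor 4 of \<open>integral_pair_diff_sq_le\<close> and
        division by \<open>c\<close>), and \<open>h0\<close> makes the quadratic remainder the
        last.\<close>
      define Q where "Q = \<bar>8 * L + 2 * D\<^sup>2\<bar>"
      define c where "c = e / (3 * (E t + 1))"
      have c: "c > 0" "c * E t \<le> e / 3" using e E0[of t] by (auto simp: c_def field_simps intro!: divide_pos_pos)
      define h0 where "h0 = min u (e / (3 * (Q + 1)))"
      have Q0: "0 \<le> Q" by (simp add: Q_def)
      then have h0: "h0 > 0" using u e by (simp add: h0_def)
      have "\<forall>\<^sub>F s in at_right t. (\<integral>i. ((w s i - w t i) / (s - t) - V i)\<^sup>2 \<partial>M) < e * c / 12"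
        using lim e c by (intro order_tendstoD(2)) auto
      moreover have "\<forall>\<^sub>F s in at_right t. s \<in> {t<..<t + h0}"
        using h0 by (intro eventually_at_right_real) auto
      ultimately show "\<forall>\<^sub>F s in at_right t. F s - F t \<le> e * (s - t)"
        using dstep[OF t]
      proof eventually_elim
        case (elim s)
        define h where "h = s - t"
        have h: "0 < h" "h < u" "h < e / (3 * (Q + 1))" "s = t + h" "0 \<le> s"
          using elim t0 by (auto simp: h_def h0_def)
        define \<rho> where "\<rho> i = (w s i - w t i) / (s - t) - V i" for i
        have \<rho>: "square_integrable M \<rho>"
        proof -
          have "square_integrable M (\<lambda>i. (1 / (s - t)) * (w s i - w t i) - V i)"
            by (intro square_integrable_diff square_integrable_cmult w h t0 V)
          then show ?thesis by (simp add: \<rho>_def[abs_def])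
        qed
        have sV: "square_integrable (M \<Otimes>\<^sub>M M) (\<lambda>z. V (fst z) - V (snd z) + g t * d t)"
          by (intro square_integrable_add square_integrable_pair_diff V P.square_integrable_const)
        have "(\<integral>z. p t z * (q s z - q t z) \<partial>(M \<Otimes>\<^sub>M M)) \<le>
          (\<integral>z. h * (p t z * (V (fst z) - V (snd z) + g t * d t)) + h * (p t z * (\<rho> (fst z) - \<rho> (snd z))) \<partial>(M \<Otimes>\<^sub>M M))"
        proof (rule integral_mono)
          show "integrable (M \<Otimes>\<^sub>M M) (\<lambda>z. p t z * (q s z - q t z))"
            by (intro integrable_mult_square_integrable square_integrable_diff p q h t0)
          show "integrable (M \<Otimes>\<^sub>M M) (\<lambda>z. h * (p t z * (V (fst z) - V (snd z) + g t * d t)) + h * (p t z * (\<rho> (fst z) - \<rho> (snd z))))"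
            by (intro Bochner_Integration.integrable_add integrable_mult_right integrable_mult_square_integrable
                square_integrable_pair_diff p t0 sV \<rho>)
          fix z
          have wi: "w s i - w t i = h * (V i + \<rho> i)" for i using h by (simp add: \<rho>_def)
          \<comment> \<open>The decrease of the barrier enters with a minus sign, so
            \<open>dstep\<close> turns it into the term \<open>g t * d t\<close>. Together with the
            velocities this forms the expression bounded by \<open>excess_production_le\<close>;
            \<open>\<rho>\<close> is what the difference quotient leaves over.\<close>
          have "q s z - q t z \<le> h * (V (fst z) - V (snd z) + g t * d t) + h * (\<rho> (fst z) - \<rho> (snd z))"
            using elim(3) wi[of "fst z"] wi[of "snd z"] by (simp add: q_def h_def[symmetric] algebra_simps)
          then have "p t z * (q s z - q t z) \<le> p t z * (h * (V (fst z) - V (snd z) + g t * d t) + h * (\<rho> (fst z) - \<rho> (snd z)))"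
            by (rule mult_left_mono) (simp add: p_def)
          then show "p t z * (q s z - q t z)
              \<le> h * (p t z * (V (fst z) - V (snd z) + g t * d t)) + h * (p t z * (\<rho> (fst z) - \<rho> (snd z)))"
            by (simp only: distrib_left mult.left_commute)
        qed
        also have "\<dots> = h * (\<integral>z. p t z * (V (fst z) - V (snd z) + g t * d t) \<partial>(M \<Otimes>\<^sub>M M))
            + h * (\<integral>z. p t z * (\<rho> (fst z) - \<rho> (snd z)) \<partial>(M \<Otimes>\<^sub>M M))"
          using integrable_mult_square_integrable[OF p[OF t0] sV]
            integrable_mult_square_integrable[OF p[OF t0] square_integrable_pair_diff[OF \<rho>]] by simp
        finally have "2 * (\<integral>z. p t z * (q s z - q t z) \<partial>(M \<Otimes>\<^sub>M M))
          \<le> h * (2 * (\<integral>z. p t z * (V (fst z) - V (snd z) + g t * d t) \<partial>(M \<Otimes>\<^sub>M M)))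
            + h * (2 * (\<integral>z. p t z * (\<rho> (fst z) - \<rho> (snd z)) \<partial>(M \<Otimes>\<^sub>M M)))" by simp
        also have "\<dots> \<le> h * (C * E t) + h * (e / 3 + e / 3)"
        proof (intro add_mono mult_left_mono)
          show "2 * (\<integral>z. p t z * (V (fst z) - V (snd z) + g t * d t) \<partial>(M \<Otimes>\<^sub>M M)) \<le> C * E t"
            by (rule prod)
          have "2 * (\<integral>z. p t z * (\<rho> (fst z) - \<rho> (snd z)) \<partial>(M \<Otimes>\<^sub>M M))
            \<le> c * E t + (1 / c) * (\<integral>z. (\<rho> (fst z) - \<rho> (snd z))\<^sup>2 \<partial>(M \<Otimes>\<^sub>M M))"
            unfolding E_def by (intro integral_mult_le_weighted p t0 square_integrable_pair_diff \<rho> c)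
          also have "(\<integral>i. (\<rho> i)\<^sup>2 \<partial>M) < e * c / 12" using elim(1) by (simp add: \<rho>_def)
          then have "(1 / c) * (\<integral>z. (\<rho> (fst z) - \<rho> (snd z))\<^sup>2 \<partial>(M \<Otimes>\<^sub>M M)) \<le> (1 / c) * (4 * (e * c / 12))"
            using integral_pair_diff_sq_le[OF \<rho>] c(1) by (intro mult_left_mono) (linarith, simp)
          also have "(1 / c) * (4 * (e * c / 12)) = e / 3" using c by simp
          finally show "2 * (\<integral>z. p t z * (\<rho> (fst z) - \<rho> (snd z)) \<partial>(M \<Otimes>\<^sub>M M)) \<le> e / 3 + e / 3"
            using c by linarith
        qed (use h in auto)
        moreover have "(\<integral>z. (q s z - q t z)\<^sup>2 \<partial>(M \<Otimes>\<^sub>M M)) \<le> h * (e / 3)"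
        proof -
          have "(\<integral>z. (q s z - q t z)\<^sup>2 \<partial>(M \<Otimes>\<^sub>M M)) \<le> (8 * L + 2 * D\<^sup>2) * h\<^sup>2"
            unfolding h_def using h t0 u by (intro qdiff L) (auto simp: dist_real_def)
          also have "\<dots> \<le> (Q + 1) * h\<^sup>2" by (intro mult_right_mono) (auto simp: Q_def)
          also have "\<dots> = h * ((Q + 1) * h)" by (simp add: power2_eq_square)
          also have "(Q + 1) * h \<le> e / 3" using h(3) Q0 by (simp add: pos_less_divide_eq mult_ac)
          then have "h * ((Q + 1) * h) \<le> h * (e / 3)" using h by (intro mult_left_mono) auto
          finally show ?thesis .
        qed
        ultimately have "E s - E t \<le> (C * E t + e) * h"
          using expand[OF h(5) t0] by (simp add: algebra_simps)
        then show ?case using e elim(2) t0 by (intro Fstep) (auto simp: h_def)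
      qed
    qed
  qed
  moreover have "E 0 = 0"
  proof -
    have "{z \<in> space (M \<Otimes>\<^sub>M M). q 0 z \<le> 0} \<in> sets (M \<Otimes>\<^sub>M M)"
      using square_integrableD(1)[OF q[of 0]] by measurable
    then have "AE z in M \<Otimes>\<^sub>M M. q 0 z \<le> 0"
      using init by (intro P.AE_pair_measure) (auto simp: q_def)
    then show ?thesis unfolding E_def
      by (intro integral_eq_zero_AE) (auto simp: p_def max_def)
  qed
  ultimately have "exp (- (C * T)) * E T \<le> 0" by (simp add: F_def)
  then have "E T = 0" using E0[of T] by (simp add: mult_le_0_iff)
  then have "AE z in M \<Otimes>\<^sub>M M. (p T z)\<^sup>2 = 0"
    unfolding E_def using square_integrableD(2)[OF p[OF T]]
    by (subst (asm) integral_nonneg_eq_0_iff_AE) auto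
  then have "AE z in M \<Otimes>\<^sub>M M. q T z \<le> 0"
    by eventually_elim (simp add: p_def max_def split: if_splits)
  from P.AE_pair[OF this] show ?thesis by (simp add: q_def)
qed

end

subsection \<open>Lebesgue measure on products\<close>

lemma prob_space_leb_I: "prob_space leb_I"
  by (rule prob_spaceI) (simp add: emeasure_restrict_space space_restrict_space)

lemma borel_measurable_leb_I: "borel_measurable borel \<subseteq> borel_measurable leb_I"
  by (auto intro!: measurable_restrict_space1 measurable_completion)

lemma AE_lebesgue_on_iff:
  fixes S :: "'a::euclidean_space set"
  assumes "S \<in> sets borel"
  shows "(AE x in lebesgue_on S. P x) \<longleftrightarrow> (AE x in lborel. x \<in> S \<longrightarrow> P x)"
  using assms by (subst AE_restrict_space_iff) (auto simp: AE_completion_iff)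

lemma AE_lebesgue_on_TimesD:
  fixes A :: "'a::euclidean_space set" and B :: "'b::euclidean_space set"
  assumes [measurable]: "A \<in> sets borel" "B \<in> sets borel" and ae: "AE z in lebesgue_on (A \<times> B). P z"
  shows "AE x in lebesgue_on A. AE y in lebesgue_on B. P (x, y)"
proof -
  have "A \<times> B \<in> sets borel" using assms by (simp add: borel_Times)
  with ae have "AE z in lborel \<Otimes>\<^sub>M lborel. z \<in> A \<times> B \<longrightarrow> P z"
    unfolding lborel_prod by (simp add: AE_lebesgue_on_iff)
  from lborel_pair.AE_pair[OF this] show ?thesis
    using assms by (auto simp: AE_lebesgue_on_iff elim!: eventually_mono)
qed

text \<open>Fubini is available for the Borel product, while the exceptional set \<open>N\<close> is
  measurable only for the completed planar measure. Its Borel main part has the same measure and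
  lies inside \<open>N\<close>, so almost all of its sections are null.\<close>

lemma AE_lebesgue_on_TimesI:
  fixes A :: "'a::euclidean_space set" and B :: "'b::euclidean_space set"
  assumes AB: "A \<in> sets borel" "B \<in> sets borel"
    and ae: "AE x in lebesgue_on A. AE y in lebesgue_on B. P (x, y)"
    and m: "{z \<in> A \<times> B. P z} \<in> sets (lebesgue_on (A \<times> B))"
  shows "AE z in lebesgue_on (A \<times> B). P z"
proof -
  have ABm: "A \<times> B \<in> sets borel" using AB by (simp add: borel_Times)
  then have ABl: "A \<times> B \<in> sets lebesgue" by simp
  define N where "N = A \<times> B - {z \<in> A \<times> B. P z}"
  have "{z \<in> A \<times> B. P z} \<in> sets lebesgue"
    using m ABl by (subst (asm) sets_restrict_space_iff) auto
  with ABl have N: "N \<in> sets lebesgue" unfolding N_def by blast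
  define Q where "Q = main_part lborel N"
  have Qs: "Q \<in> sets lborel" using main_part_sets[OF N] by (simp add: Q_def)
  then have Qp: "Q \<in> sets (lborel \<Otimes>\<^sub>M lborel)" by (simp only: lborel_prod)
  have QN: "Q \<subseteq> N" unfolding Q_def using main_part_null_part_Un[OF N] by blast
  have "AE x in lborel. AE y in lborel. (x, y) \<notin> Q"
    using ae QN by (auto simp: AE_lebesgue_on_iff AB N_def elim!: eventually_mono)
  moreover have "{z \<in> space (lborel \<Otimes>\<^sub>M lborel). z \<notin> Q} \<in> sets (lborel \<Otimes>\<^sub>M lborel)"
    using sets.compl_sets[OF Qp] by (simp add: set_diff_eq)
  ultimately have "AE z in lborel \<Otimes>\<^sub>M lborel. z \<notin> Q"
    by (rule lborel_pair.AE_pair_measure[rotated])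
  then have "AE z in lborel. z \<notin> Q" unfolding lborel_prod .
  then have "emeasure lborel Q = 0" using Qs by (subst (asm) AE_iff_measurable[of Q]) auto
  then have "emeasure lebesgue N = 0" using N by (simp add: Q_def)
  then have "AE z in lebesgue. z \<notin> N" using N by (intro AE_not_in) (simp add: null_sets_def)
  then show ?thesis
    using ABl by (subst AE_restrict_space_iff) (auto simp: N_def elim!: eventually_mono)
qed

text \<open>Between completed measures, Borel measurability has to be supplemented by null preimages
  of null sets; here these preimages are the strips \<open>X \<times> UNIV\<close>.\<close>

lemma measurable_fst_lebesgue:
  "fst \<in> (lebesgue :: ('a::euclidean_space \<times> 'b::euclidean_space) measure) \<rightarrow>\<^sub>M lebesgue"
proof (rule completion.measurable_completion2)
  show m: "fst \<in> (lebesgue :: ('a \<times> 'b) measure) \<rightarrow>\<^sub>M lborel"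
    by (intro measurable_completion) (simp add: lborel_prod[symmetric])
  show "null_sets lborel \<subseteq> null_sets (distr (lebesgue :: ('a \<times> 'b) measure) lborel fst)"
  proof
    fix X :: "'a set" assume X: "X \<in> null_sets lborel"
    then have "X \<times> (UNIV :: 'b set) \<in> null_sets (lborel \<Otimes>\<^sub>M lborel)"
      by (intro lborel.times_in_null_sets1) auto
    then have "X \<times> (UNIV :: 'b set) \<in> null_sets lebesgue" by (simp add: lborel_prod null_sets_completionI)
    moreover have "fst -` X = X \<times> (UNIV :: 'b set)" by auto
    ultimately show "X \<in> null_sets (distr (lebesgue :: ('a \<times> 'b) measure) lborel fst)"
      using X m by (simp add: null_sets_def emeasure_distr)
  qed
qed

lemma measurable_snd_lebesgue:
  "snd \<in> (lebesgue :: ('a::euclidean_space \<times> 'b::euclidean_space) measure) \<rightarrow>\<^sub>M lebesgue"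
proof (rule completion.measurable_completion2)
  show m: "snd \<in> (lebesgue :: ('a \<times> 'b) measure) \<rightarrow>\<^sub>M lborel"
    by (intro measurable_completion) (simp add: lborel_prod[symmetric])
  show "null_sets lborel \<subseteq> null_sets (distr (lebesgue :: ('a \<times> 'b) measure) lborel snd)"
  proof
    fix X :: "'b set" assume X: "X \<in> null_sets lborel"
    then have "(UNIV :: 'a set) \<times> X \<in> null_sets (lborel \<Otimes>\<^sub>M lborel)"
      by (intro lborel.times_in_null_sets2) auto
    then have "(UNIV :: 'a set) \<times> X \<in> null_sets lebesgue" by (simp add: lborel_prod null_sets_completionI)
    moreover have "snd -` X = (UNIV :: 'a set) \<times> X" by auto
    ultimately show "X \<in> null_sets (distr (lebesgue :: ('a \<times> 'b) measure) lborel snd)"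
      using X m by (simp add: null_sets_def emeasure_distr)
  qed
qed

lemma measurable_fst_leb_II: "fst \<in> leb_II \<rightarrow>\<^sub>M leb_I"
  by (rule measurable_restrict_space3[OF measurable_fst_lebesgue]) auto

lemma measurable_snd_leb_II: "snd \<in> leb_II \<rightarrow>\<^sub>M leb_I"
  by (rule measurable_restrict_space3[OF measurable_snd_lebesgue]) auto

lemma borel_measurable_norm_diff_leb_II:
  fixes y :: "real \<Rightarrow> 'a::euclidean_space"
  assumes "y \<in> borel_measurable leb_I"
  shows "(\<lambda>(i, j). norm (y i - y j)) \<in> borel_measurable leb_II"
  using measurable_compose[OF measurable_fst_leb_II assms] measurable_compose[OF measurable_snd_leb_II assms]
  unfolding case_prod_beta' by measurable

lemma prob_space_leb_II: "prob_space leb_II"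
proof (rule prob_spaceI)
  have "emeasure lborel ({0..1::real} \<times> {0..1::real}) = 1"
    by (simp add: lborel_prod[symmetric] lborel.emeasure_pair_measure_Times)
  then show "emeasure leb_II (space leb_II) = 1"
    by (simp add: emeasure_restrict_space space_restrict_space borel_Times)
qed

text \<open>Completeness of Lebesgue measure transfers measurability along almost-everywhere
  equality. Sections of \<open>a\<close> can thus be exchanged for sections of a Borel version under
  an integral, without knowing in advance that they are measurable.\<close>

lemma borel_measurable_leb_I_AE:
  fixes f g :: "real \<Rightarrow> 'a::euclidean_space"
  assumes ae: "AE i in leb_I. f i = g i" and g: "g \<in> borel_measurable leb_I"
  shows "f \<in> borel_measurable leb_I"
proof -
  have S: "{0..1::real} \<in> sets lebesgue" by simp
  let ?f = "\<lambda>i. if i \<in> {0..1} then f i else 0" and ?g = "\<lambda>i. if i \<in> {0..1} then g i else 0"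
  have gm: "?g \<in> borel_measurable lebesgue" using g S by (rule borel_measurable_if_I)
  have ae': "AE i in lebesgue. ?f i = ?g i"
    using ae S by (auto simp: AE_restrict_space_iff elim!: eventually_mono)
  have "?f \<in> borel_measurable lebesgue"
  proof (rule measurableI)
    fix X :: "'a set" assume "X \<in> sets borel"
    then have "?g -` X \<inter> space lebesgue \<in> sets lebesgue" using gm by (rule measurable_sets[rotated])
    then show "?f -` X \<inter> space lebesgue \<in> sets lebesgue"
      by (rule completion.in_sets_AE[rotated]) (use ae' in \<open>auto elim!: eventually_mono\<close>)
  qed simp
  then show ?thesis by (rule borel_measurable_if_D)
qed

lemma integral_leb_I_cong_AE:
  fixes f g :: "real \<Rightarrow> 'a::euclidean_space"
  assumes "AE i in leb_I. f i = g i" "g \<in> borel_measurable leb_I"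
  shows "(LINT i|leb_I. f i) = (LINT i|leb_I. g i)"
  by (rule integral_cong_AE[OF borel_measurable_leb_I_AE[OF assms] assms(2,1)])

text \<open>A Lebesgue measurable \<open>a\<close> may have non-measurable slices at exceptional
  times, and a slice that is measurable for the planar measure need not be so for the product
  sigma-algebra on which Fubini operates. A Borel version of \<open>a\<close> in all three variables
  supplies a slice with both properties. Agreement for almost every \<open>i\<close> and almost
  every \<open>j\<close> is all that the integrals in the equation detect.\<close>

lemma AE_kernel_borel_representative:
  fixes a :: "real \<Rightarrow> real \<Rightarrow> real \<Rightarrow> real"
  assumes am: "(\<lambda>(t, i, j). a t i j) \<in> borel_measurable (lebesgue_on ({0..} \<times> {0..1} \<times> {0..1}))"
    and a: "\<And>t i j. t \<ge> 0 \<Longrightarrow> i \<in> {0..1} \<Longrightarrow> j \<in> {0..1} \<Longrightarrow> a t i j \<in> {0..1}"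
  shows "AE t in lebesgue_on {0..}. \<exists>b. case_prod b \<in> borel_measurable (leb_I \<Otimes>\<^sub>M leb_I) \<and>
    (\<forall>i j. 0 \<le> b i j \<and> b i j \<le> 1) \<and> (AE i in leb_I. AE j in leb_I. a t i j = b i j)"
proof -
  define S :: "(real \<times> real \<times> real) set" where "S = {0..} \<times> {0..1} \<times> {0..1}"
  have Sb: "S \<in> sets borel" by (simp add: S_def borel_Times)
  have "(\<lambda>z. if z \<in> S then (\<lambda>(t, i, j). a t i j) z else 0) \<in> borel_measurable lebesgue"
    using am Sb by (intro borel_measurable_if_I) (auto simp: S_def)
  then obtain f where f: "f \<in> borel_measurable lborel"
    and ae: "AE z in lborel. (if z \<in> S then (\<lambda>(t, i, j). a t i j) z else 0) = f z"
    using completion_ex_borel_measurable_real by blast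
  have "AE z in lebesgue_on S. (\<lambda>(t, i, j). a t i j) z = f z"
    using ae by (auto simp: AE_lebesgue_on_iff[OF Sb] elim!: eventually_mono)
  then have "AE t in lebesgue_on {0..}. AE z in leb_II. (\<lambda>(t, i, j). a t i j) (t, z) = f (t, z)"
    unfolding S_def by (intro AE_lebesgue_on_TimesD) (auto simp: borel_Times)
  then show ?thesis
    using AE_space
  proof eventually_elim
    case (elim t)
    then have t: "0 \<le> t" by simp
    from elim(1) have "AE i in leb_I. AE j in leb_I. (\<lambda>(t, i, j). a t i j) (t, i, j) = f (t, i, j)"
      by (intro AE_lebesgue_on_TimesD) auto
    then have *: "AE i in leb_I. AE j in leb_I. a t i j = f (t, i, j)" by simp
    \<comment> \<open>The Borel version can leave \<open>[0, 1]\<close> on a null set. Clipping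
      restores the bounds everywhere and changes nothing where it agrees with
      \<open>a\<close>.\<close>
    define b where "b i j = max 0 (min 1 (f (t, i, j)))" for i j
    have [measurable]: "(\<lambda>x. x) \<in> leb_I \<rightarrow>\<^sub>M borel" using borel_measurable_leb_I by auto
    have [measurable]: "f \<in> borel_measurable (borel \<Otimes>\<^sub>M borel \<Otimes>\<^sub>M borel)"
      using f by (simp add: borel_prod)
    have "(\<lambda>z. f (t, fst z, snd z)) \<in> borel_measurable (leb_I \<Otimes>\<^sub>M leb_I)" by measurable
    then have "case_prod b \<in> borel_measurable (leb_I \<Otimes>\<^sub>M leb_I)"
      unfolding b_def case_prod_beta' by measurable
    moreover have "AE i in leb_I. AE j in leb_I. a t i j = b i j"
      using * AE_space
    proof eventually_elim
      case (elim i)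
      from elim(1) AE_space show ?case
      proof eventually_elim
        case (elim j)
        then show ?case using a[OF t, of i j] \<open>i \<in> space leb_I\<close> by (auto simp: b_def)
      qed
    qed
    ultimately show ?case by (intro exI[of _ b]) (auto simp: b_def)
  qed
qed

text \<open>\<open>diameter_decay\<close> wants its rate bounded at every time, including those at
  which the slice of \<open>a\<close> is not measurable. There the default value 0 of the integral
  and of the conversion to a real number is still compatible with the bounds.\<close>

lemma scrambling_coeff_bounds:
  assumes k: "\<And>i j. i \<in> {0..1} \<Longrightarrow> j \<in> {0..1} \<Longrightarrow> k i j \<in> {0..1}"
  shows "0 \<le> scrambling_coeff k" "scrambling_coeff k \<le> 1"
    "AE z in leb_II. scrambling_coeff k \<le> (LINT l|leb_I. min (k (fst z) l) (k (snd z) l))"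
proof -
  define f where "f i j = (LINT l|leb_I. min (k i l) (k j l))" for i j
  interpret I: prob_space leb_I by (rule prob_space_leb_I)
  interpret II: prob_space leb_II by (rule prob_space_leb_II)
  have f: "0 \<le> f i j" "f i j \<le> 1" if ij: "i \<in> {0..1}" "j \<in> {0..1}" for i j
  proof -
    have l: "min (k i l) (k j l) \<in> {0..1}" if "l \<in> space leb_I" for l
      using k[OF ij(1), of l] k[OF ij(2), of l] that by (auto simp: min_def)
    show "0 \<le> f i j" unfolding f_def using l by (intro Bochner_Integration.integral_nonneg) auto
    show "f i j \<le> 1"
    proof (cases "integrable leb_I (\<lambda>l. min (k i l) (k j l))")
      case True
      then show ?thesis unfolding f_def using l by (intro I.integral_le_const AE_I2) auto
    qed (simp add: f_def not_integrable_integral_eq)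
  qed
  have sc: "scrambling_coeff k = real_of_ereal (- esssup leb_II (\<lambda>z. - ereal (f (fst z) (snd z))))"
    by (simp add: scrambling_coeff_def essinf_def f_def case_prod_beta')
  define e where "e = esssup leb_II (\<lambda>z. - ereal (f (fst z) (snd z)))"
  have fz: "0 \<le> f (fst z) (snd z)" "f (fst z) (snd z) \<le> 1" if "z \<in> space leb_II" for z
    using that f by auto
  have "0 \<le> scrambling_coeff k \<and> scrambling_coeff k \<le> 1 \<and> (AE z in leb_II. scrambling_coeff k \<le> f (fst z) (snd z))"
  proof (cases "(\<lambda>z. - ereal (f (fst z) (snd z))) \<in> borel_measurable leb_II")
    case True
    have "e \<le> 0" unfolding e_def using True fz by (intro esssup_I AE_I2) auto
    moreover have "ereal (- 1) \<le> e"
    proof -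
      have "esssup leb_II (\<lambda>z. ereal (- 1)) = ereal (- 1)"
        by (rule esssup_const) (use II.emeasure_space_1 in force)
      moreover have "esssup leb_II (\<lambda>z. ereal (- 1)) \<le> e"
        unfolding e_def using fz by (intro esssup_AE_mono AE_I2) auto
      ultimately show ?thesis by simp
    qed
    ultimately obtain r where r: "e = ereal r" "r \<le> 0" "- 1 \<le> r"
      by (cases e) auto
    have "AE z in leb_II. - ereal (f (fst z) (snd z)) \<le> ereal r"
      using esssup_AE[of "\<lambda>z. - ereal (f (fst z) (snd z))" leb_II] r by (simp add: e_def)
    then have "AE z in leb_II. - r \<le> f (fst z) (snd z)" by eventually_elim simp
    then show ?thesis using r sc[folded e_def] by simp
  next
    case False
    \<comment> \<open>The essential supremum of a non-measurable function is \<infinity> by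
      convention; the conversion then sends -\<infinity> to 0, a valid lower bound for the
      nonnegative overlaps.\<close>
    then have "scrambling_coeff k = 0" by (simp add: sc esssup_non_measurable top_ereal_def)
    then show ?thesis using fz by (auto intro!: AE_I2)
  qed
  then show "0 \<le> scrambling_coeff k" "scrambling_coeff k \<le> 1"
    "AE z in leb_II. scrambling_coeff k \<le> (LINT l|leb_I. min (k (fst z) l) (k (snd z) l))"
    by (auto simp: f_def)
qed

subsection \<open>Decay of the diameter\<close>

lemma norm_add_square_le: "(norm (x + y))\<^sup>2 \<le> 2 * (norm x)\<^sup>2 + 2 * (norm (y :: 'a::real_normed_vector))\<^sup>2"
proof -
  have "(norm (x + y))\<^sup>2 \<le> (norm x + norm y)\<^sup>2" by (intro power_mono norm_triangle_ineq) auto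
  then show ?thesis using power2_add_le[of "norm x" "norm y"] by linarith
qed

lemma in_L2_add:
  assumes f: "in_L2 f" and g: "in_L2 g"
  shows "in_L2 (\<lambda>i. f i + g i)"
proof -
  have [measurable]: "f \<in> borel_measurable leb_I" "g \<in> borel_measurable leb_I"
    using f g by (auto simp: in_L2_def)
  have "integrable leb_I (\<lambda>i. 2 * (norm (f i))\<^sup>2 + 2 * (norm (g i))\<^sup>2)"
    using f g by (simp add: in_L2_def)
  then have "integrable leb_I (\<lambda>i. (norm (f i + g i))\<^sup>2)"
  proof (rule Bochner_Integration.integrable_bound)
    show "AE i in leb_I. norm ((norm (f i + g i))\<^sup>2) \<le> norm (2 * (norm (f i))\<^sup>2 + 2 * (norm (g i))\<^sup>2)"
    proof (rule AE_I2)
      fix i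
      show "norm ((norm (f i + g i))\<^sup>2) \<le> norm (2 * (norm (f i))\<^sup>2 + 2 * (norm (g i))\<^sup>2)"
        using norm_add_square_le[of "f i" "g i"] by simp
    qed
  qed measurable
  then show ?thesis by (simp add: in_L2_def)
qed

lemma in_L2_scaleR:
  assumes "in_L2 f" shows "in_L2 (\<lambda>i. c *\<^sub>R f i)"
proof -
  have [measurable]: "f \<in> borel_measurable leb_I" using assms by (auto simp: in_L2_def)
  show ?thesis using assms by (simp add: in_L2_def power_mult_distrib)
qed

lemma in_L2_diff:
  "in_L2 f \<Longrightarrow> in_L2 g \<Longrightarrow> in_L2 (\<lambda>i. f i - g i)"
  using in_L2_add[of f "\<lambda>i. (-1) *\<^sub>R g i"] in_L2_scaleR[of g "-1"] by simp

lemma norm_L2_square: "(norm_L2 f)\<^sup>2 = (LINT i|leb_I. (norm (f i))\<^sup>2)"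
  by (simp add: norm_L2_def)

lemma norm_L2_nonneg: "0 \<le> norm_L2 f"
  by (simp add: norm_L2_def)

lemma inner_square_le: "(v \<bullet> y)\<^sup>2 \<le> (norm v)\<^sup>2 * (norm (y :: 'a::real_inner))\<^sup>2"
proof -
  have "\<bar>v \<bullet> y\<bar>\<^sup>2 \<le> (norm v * norm y)\<^sup>2" by (intro power_mono Cauchy_Schwarz_ineq2) auto
  then show ?thesis by (simp add: power_mult_distrib)
qed

lemma inner_in_L2:
  fixes f :: "real \<Rightarrow> 'a::euclidean_space"
  assumes f: "in_L2 f"
  shows "square_integrable leb_I (\<lambda>i. v \<bullet> f i)"
    and "(LINT i|leb_I. (v \<bullet> f i)\<^sup>2) \<le> (norm v)\<^sup>2 * (norm_L2 f)\<^sup>2"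
proof -
  have [measurable]: "f \<in> borel_measurable leb_I" and i: "integrable leb_I (\<lambda>i. (norm (f i))\<^sup>2)"
    using f by (auto simp: in_L2_def)
  have "square_integrable leb_I (\<lambda>i. norm v * norm (f i))"
    using i by (simp add: square_integrable_def power_mult_distrib)
  then show sq: "square_integrable leb_I (\<lambda>i. v \<bullet> f i)"
    by (rule square_integrable_bound) (auto simp: abs_mult Cauchy_Schwarz_ineq2)
  have "(LINT i|leb_I. (v \<bullet> f i)\<^sup>2) \<le> (LINT i|leb_I. (norm v)\<^sup>2 * (norm (f i))\<^sup>2)"
    using i square_integrableD(2)[OF sq] inner_square_le by (intro integral_mono) auto
  then show "(LINT i|leb_I. (v \<bullet> f i)\<^sup>2) \<le> (norm v)\<^sup>2 * (norm_L2 f)\<^sup>2"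
    by (simp add: norm_L2_square)
qed

text \<open>The inequality is closed in \<open>v\<close>, so it extends from \<open>C\<close> to all
  vectors, and \<open>v = z\<close> gives the norm. With a countable \<open>C\<close>, the
  exceptional null sets of all directions have a null union.\<close>

lemma norm_le_of_dense:
  fixes z :: "'a::real_inner"
  assumes c: "0 \<le> c" and dense: "\<And>X. open X \<Longrightarrow> X \<noteq> {} \<Longrightarrow> \<exists>v\<in>C. v \<in> X" and le: "\<And>v. v \<in> C \<Longrightarrow> v \<bullet> z \<le> norm v * c"
  shows "norm z \<le> c"
proof -
  have "closed {v. v \<bullet> z \<le> norm v * c}" by (intro closed_Collect_le continuous_intros)
  then have "open (- {v. v \<bullet> z \<le> norm v * c})" by (rule open_Compl)
  then have all: "v \<bullet> z \<le> norm v * c" for v using dense le by fastforce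
  have zz: "norm z * norm z \<le> norm z * c" using all[of z] by (simp add: dot_square_norm power2_eq_square)
  then show ?thesis using c by (cases "z = 0") auto
qed

text \<open>The scalar bound applies to \<open>v \<bullet> x\<close> for every \<open>v\<close> in a countable dense set, with the same kernel \<open>K\<close>.\<close>

lemma diameter_decay:
  fixes x :: "real \<Rightarrow> real \<Rightarrow> 'a::euclidean_space" and g :: "real \<Rightarrow> real"
  assumes lip: "Lip_loc_L2 x" and T: "0 \<le> T"
    and gm: "g \<in> borel_measurable (lebesgue_on {0..T})"
    and g: "\<And>t. t \<in> {0..T} \<Longrightarrow> 0 \<le> g t \<and> g t \<le> G"
    and ae: "AE t in lebesgue. t \<in> {0..<T} \<longrightarrow> (\<exists>K V. has_L2_derivative x V t \<and>
      case_prod K \<in> borel_measurable (leb_I \<Otimes>\<^sub>M leb_I) \<and> (\<forall>i k. 0 \<le> K i k \<and> K i k \<le> \<Phi>) \<and>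
      (AE i in leb_I. V i = (LINT k|leb_I. K i k *\<^sub>R (x t k - x t i))) \<and>
      (AE i in leb_I. AE j in leb_I. g t \<le> (LINT k|leb_I. min (K i k) (K j k))))"
    and D0: "0 \<le> D0" and init: "AE z in leb_II. norm (x 0 (fst z) - x 0 (snd z)) \<le> D0"
  shows "AE z in leb_II. norm (x T (fst z) - x T (snd z)) \<le> D0 * exp (- (LINT t|lebesgue_on {0..T}. g t))"
proof -
  interpret I: prob_space leb_I by (rule prob_space_leb_I)
  define J where "J = (LINT t|lebesgue_on {0..T}. g t)"
  have G0: "0 \<le> G" using g[of 0] T by auto
  have xL2: "in_L2 (x t)" if "0 \<le> t" for t using lip that by (auto simp: Lip_loc_L2_def)
  have init': "AE i in leb_I. AE j in leb_I. norm (x 0 i - x 0 j) \<le> D0"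
    using AE_lebesgue_on_TimesD[OF _ _ init] by simp
  \<comment> \<open>The slack \<open>e\<close> is the gap between the integral \<open>J\<close> of
    the rate and its approximation \<open>u T\<close> from below.\<close>
  have scalar: "AE i in leb_I. AE j in leb_I. v \<bullet> (x T i - x T j) \<le> norm v * (D0 * exp (e - J))"
    if e: "0 < e" for v :: 'a and e
  proof -
    obtain u where u0: "u 0 = 0"
      and uinc: "\<And>s t. 0 \<le> s \<Longrightarrow> s \<le> t \<Longrightarrow> 0 \<le> u t - u s \<and> u t - u s \<le> G * (t - s)"
      and ustep: "\<And>t. t \<in> {0..<T} \<Longrightarrow> \<forall>\<^sub>F s in at_right t. u s - u t \<le> g t * (s - t)"
      and uT: "(LINT t|lebesgue_on {0..T}. g t) - e \<le> u T"
      by (rule right_subderivative_approx[OF T gm g e]) blast+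
    define c where "c = norm v * D0"
    have c0: "0 \<le> c" using D0 by (simp add: c_def)
    define d where "d t = c * exp (- u t)" for t
    have u_nonneg: "0 \<le> u t" if "0 \<le> t" for t using uinc[of 0 t] u0 that by simp
    \<comment> \<open>The tangent-line bound for \<open>exp\<close> limits the drop of the barrier
      to \<open>d t * (u s - u t)\<close> exactly, without a second-order remainder;
      \<open>ustep\<close> then turns this into the rate \<open>g t * d t\<close> required of a
      barrier.\<close>
    have dincr: "d t - d t * (u s - u t) \<le> d s" for s t
    proof -
      have "1 - (u s - u t) \<le> exp (- (u s - u t))" using exp_ge_add_one_self[of "- (u s - u t)"] by linarith
      then have "d t * (1 - (u s - u t)) \<le> d t * exp (- (u s - u t))"
        using c0 by (intro mult_left_mono) (auto simp: d_def)
      also have "\<dots> = d s" by (simp add: d_def exp_diff exp_minus field_simps)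
      finally show ?thesis by (simp add: algebra_simps)
    qed
    have dmono: "\<bar>d s - d r\<bar> \<le> c * G * \<bar>s - r\<bar>" if "0 \<le> r" "r \<le> s" for r s
    proof -
      have "d s \<le> d r" using uinc[OF that] c0 by (auto simp: d_def intro!: mult_left_mono)
      moreover have "d r \<le> c * 1" unfolding d_def using u_nonneg[OF that(1)] c0 by (intro mult_left_mono) auto
      then have "d r * (u s - u r) \<le> c * (G * (s - r))"
        using uinc[OF that] c0 by (intro mult_mono) auto
      ultimately show ?thesis using dincr[of r s] that by simp
    qed
    have "AE i in leb_I. AE j in leb_I. v \<bullet> x T i - v \<bullet> x T j \<le> d T"
    proof (rule I.spread_le_barrier[OF T, where g = g and \<Phi> = \<Phi> and D = "c * G" and d = d and w = "\<lambda>t i. v \<bullet> x t i"])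
      show "square_integrable leb_I (\<lambda>i. v \<bullet> x t i)" if "0 \<le> t" for t
        by (rule inner_in_L2(1)[OF xL2[OF that]])
      show "\<exists>u>0. \<exists>L. \<forall>r\<in>cball t u \<inter> {0..}. \<forall>s\<in>cball t u \<inter> {0..}.
          (LINT i|leb_I. (v \<bullet> x r i - v \<bullet> x s i)\<^sup>2) \<le> L * (r - s)\<^sup>2" if t: "0 \<le> t" for t
      proof -
        obtain u L where u: "u > 0" and L: "\<And>r s. r \<in> cball t u \<inter> {0..} \<Longrightarrow> s \<in> cball t u \<inter> {0..} \<Longrightarrow>
          norm_L2 (\<lambda>i. x r i - x s i) \<le> L * \<bar>r - s\<bar>"
          using lip t unfolding Lip_loc_L2_def by blast
        have "(LINT i|leb_I. (v \<bullet> x r i - v \<bullet> x s i)\<^sup>2) \<le> ((norm v)\<^sup>2 * L\<^sup>2) * (r - s)\<^sup>2"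
          if r: "r \<in> cball t u \<inter> {0..}" and s: "s \<in> cball t u \<inter> {0..}" for r s
        proof -
          have "in_L2 (\<lambda>i. x r i - x s i)" using r s by (intro in_L2_diff xL2) auto
          from inner_in_L2(2)[OF this, of v]
          have "(LINT i|leb_I. (v \<bullet> x r i - v \<bullet> x s i)\<^sup>2) \<le> (norm v)\<^sup>2 * (norm_L2 (\<lambda>i. x r i - x s i))\<^sup>2"
            by (simp add: inner_diff_right)
          also have "\<dots> \<le> (norm v)\<^sup>2 * (L * \<bar>r - s\<bar>)\<^sup>2"
            using L[OF r s] norm_L2_nonneg by (intro mult_left_mono power_mono) auto
          finally show ?thesis by (simp add: power_mult_distrib mult_ac)
        qed
        then show ?thesis using u by blast
      qed
      show "0 \<le> d t" for t using c0 by (simp add: d_def)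
      show "\<bar>d s - d r\<bar> \<le> c * G * \<bar>s - r\<bar>" if "0 \<le> r" "0 \<le> s" for r s
        using dmono[of r s] dmono[of s r] that by (cases "r \<le> s") (auto simp: abs_minus_commute)
      show "\<forall>\<^sub>F s in at_right t. - (g t * d t * (s - t)) \<le> d s - d t" if "t \<in> {0..<T}" for t
        using ustep[OF that]
      proof eventually_elim
        case (elim s)
        have "d t * (u s - u t) \<le> d t * (g t * (s - t))"
          using elim c0 by (intro mult_left_mono) (auto simp: d_def)
        then show ?case using dincr[of t s] by (simp add: mult_ac)
      qed
      show "0 \<le> g t" if "t \<in> {0..<T}" for t using g[of t] that by auto
      have pt: "v \<bullet> x 0 i - v \<bullet> x 0 j \<le> d 0" if "norm (x 0 i - x 0 j) \<le> D0" for i j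
      proof -
        have "norm v * norm (x 0 i - x 0 j) \<le> c" unfolding c_def using that by (intro mult_left_mono) auto
        then show ?thesis
          using norm_cauchy_schwarz[of v "x 0 i - x 0 j"] by (simp add: d_def u0 inner_diff_right)
      qed
      show "AE i in leb_I. AE j in leb_I. v \<bullet> x 0 i - v \<bullet> x 0 j \<le> d 0"
        using init' by (auto elim!: eventually_mono intro: pt)
      show "AE t in lebesgue. t \<in> {0..<T} \<longrightarrow> (\<exists>K V. square_integrable leb_I V \<and>
        case_prod K \<in> borel_measurable (leb_I \<Otimes>\<^sub>M leb_I) \<and>
        (\<forall>i\<in>space leb_I. \<forall>k\<in>space leb_I. 0 \<le> K i k \<and> K i k \<le> \<Phi>) \<and>
        (AE i in leb_I. V i = (LINT k|leb_I. K i k * (v \<bullet> x t k - v \<bullet> x t i))) \<and>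
        (AE i in leb_I. AE j in leb_I. g t \<le> (LINT k|leb_I. min (K i k) (K j k))) \<and>
        ((\<lambda>s. LINT i|leb_I. ((v \<bullet> x s i - v \<bullet> x t i) / (s - t) - V i)\<^sup>2) \<longlongrightarrow> 0) (at_right t))"
        using ae
      proof (eventually_elim, intro impI)
        fix t assume "t \<in> {0..<T} \<longrightarrow> (\<exists>K V. has_L2_derivative x V t \<and>
          case_prod K \<in> borel_measurable (leb_I \<Otimes>\<^sub>M leb_I) \<and> (\<forall>i k. 0 \<le> K i k \<and> K i k \<le> \<Phi>) \<and>
          (AE i in leb_I. V i = (LINT k|leb_I. K i k *\<^sub>R (x t k - x t i))) \<and>
          (AE i in leb_I. AE j in leb_I. g t \<le> (LINT k|leb_I. min (K i k) (K j k))))"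
          and t: "t \<in> {0..<T}"
        then obtain K V where V: "has_L2_derivative x V t"
          and K: "case_prod K \<in> borel_measurable (leb_I \<Otimes>\<^sub>M leb_I)" "\<And>i k. 0 \<le> K i k \<and> K i k \<le> \<Phi>"
          and eq: "AE i in leb_I. V i = (LINT k|leb_I. K i k *\<^sub>R (x t k - x t i))"
          and gt: "AE i in leb_I. AE j in leb_I. g t \<le> (LINT k|leb_I. min (K i k) (K j k))" by blast
        have t0: "0 \<le> t" using t by simp
        have VL2: "in_L2 V" using V by (simp add: has_L2_derivative_def)
        have [measurable]: "x t \<in> borel_measurable leb_I" using xL2[OF t0] by (simp add: in_L2_def)
        have xi: "integrable leb_I (\<lambda>k. norm (x t k))"
          by (rule I.square_integrable_imp_integrable) (use xL2[OF t0] in \<open>auto simp: in_L2_def\<close>)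
        have eqv: "AE i in leb_I. v \<bullet> V i = (LINT k|leb_I. K i k * (v \<bullet> x t k - v \<bullet> x t i))"
          using eq AE_space
        proof eventually_elim
          case (elim i)
          have [measurable]: "(\<lambda>k. K i k) \<in> borel_measurable leb_I"
            using measurable_Pair2[OF K(1) elim(2)] by simp
          have "integrable leb_I (\<lambda>k. K i k *\<^sub>R (x t k - x t i))"
          proof (rule Bochner_Integration.integrable_bound)
            show "integrable leb_I (\<lambda>k. \<Phi> * (norm (x t k) + norm (x t i)))" using xi by simp
            show "AE k in leb_I. norm (K i k *\<^sub>R (x t k - x t i)) \<le> norm (\<Phi> * (norm (x t k) + norm (x t i)))"
            proof (rule AE_I2)
              fix k
              have "norm (K i k *\<^sub>R (x t k - x t i)) = K i k * norm (x t k - x t i)" using K(2)[of i k] by simp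
              also have "\<dots> \<le> \<Phi> * (norm (x t k) + norm (x t i))"
                using K(2)[of i k] by (intro mult_mono norm_triangle_ineq4) auto
              finally show "norm (K i k *\<^sub>R (x t k - x t i)) \<le> norm (\<Phi> * (norm (x t k) + norm (x t i)))" by simp
            qed
          qed measurable
          then have "v \<bullet> V i = (LINT k|leb_I. v \<bullet> (K i k *\<^sub>R (x t k - x t i)))"
            unfolding elim(1) by (rule integral_inner_right[symmetric])
          then show ?case by (simp add: inner_diff_right)
        qed
        have lim: "((\<lambda>s. LINT i|leb_I. ((v \<bullet> x s i - v \<bullet> x t i) / (s - t) - v \<bullet> V i)\<^sup>2) \<longlongrightarrow> 0) (at_right t)"
        proof (rule tendsto_sandwich[of "\<lambda>_. 0"])
          define n where "n s = norm_L2 (\<lambda>i. (x s i - x t i) /\<^sub>R (s - t) - V i)" for s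
          have "(n \<longlongrightarrow> 0) (at t within {0..})"
            using V unfolding has_L2_derivative_def n_def by blast
          then have "(n \<longlongrightarrow> 0) (at_right t)"
            by (rule tendsto_within_subset) (use t0 in auto)
          then have "((\<lambda>s. (norm v)\<^sup>2 * (n s)\<^sup>2) \<longlongrightarrow> (norm v)\<^sup>2 * 0\<^sup>2) (at_right t)" by (intro tendsto_intros)
          then show "((\<lambda>s. (norm v)\<^sup>2 * (n s)\<^sup>2) \<longlongrightarrow> 0) (at_right t)" by simp
          show "\<forall>\<^sub>F s in at_right t. (LINT i|leb_I. ((v \<bullet> x s i - v \<bullet> x t i) / (s - t) - v \<bullet> V i)\<^sup>2) \<le> (norm v)\<^sup>2 * (n s)\<^sup>2"
            using eventually_at_right_less[of t]
          proof eventually_elim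
            case (elim s)
            have "in_L2 (\<lambda>i. inverse (s - t) *\<^sub>R (x s i - x t i) - V i)"
              using elim t0 by (intro in_L2_diff in_L2_scaleR xL2 VL2) auto
            from inner_in_L2(2)[OF this, of v] show ?case
              by (simp add: n_def inner_diff_right divide_inverse algebra_simps)
          qed
        qed (auto intro!: always_eventually Bochner_Integration.integral_nonneg)
        show "\<exists>K V. square_integrable leb_I V \<and>
          case_prod K \<in> borel_measurable (leb_I \<Otimes>\<^sub>M leb_I) \<and>
          (\<forall>i\<in>space leb_I. \<forall>k\<in>space leb_I. 0 \<le> K i k \<and> K i k \<le> \<Phi>) \<and>
          (AE i in leb_I. V i = (LINT k|leb_I. K i k * (v \<bullet> x t k - v \<bullet> x t i))) \<and>
          (AE i in leb_I. AE j in leb_I. g t \<le> (LINT k|leb_I. min (K i k) (K j k))) \<and>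
          ((\<lambda>s. LINT i|leb_I. ((v \<bullet> x s i - v \<bullet> x t i) / (s - t) - V i)\<^sup>2) \<longlongrightarrow> 0) (at_right t)"
          using inner_in_L2(1)[OF VL2] K eqv gt lim
          by (intro exI[of _ K] exI[of _ "\<lambda>i. v \<bullet> V i"]) blast
      qed
    qed
    moreover have "d T \<le> norm v * (D0 * exp (e - J))"
      unfolding d_def c_def mult.assoc using uT[folded J_def] D0 by (intro mult_left_mono) auto
    ultimately show ?thesis by (auto simp: inner_diff_right elim!: eventually_mono)
  qed
  obtain C :: "'a set" where C: "countable C" "\<And>X. open X \<Longrightarrow> X \<noteq> {} \<Longrightarrow> \<exists>v\<in>C. v \<in> X"
    using countable_dense_setE by blast
  \<comment> \<open>The scalar bounds hold off null sets depending on \<open>v\<close> and on the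
    slack. Restricting to \<open>C\<close> and to slacks \<open>1 / Suc n\<close> makes the choices
    countable, so the quantifiers can move inside both almost-everywhere statements; the slack then
    tends to 0.\<close>
  have "AE i in leb_I. \<forall>v\<in>C. \<forall>n. AE j in leb_I. v \<bullet> (x T i - x T j) \<le> norm v * (D0 * exp (1 / Suc n - J))"
    unfolding AE_ball_countable[OF C(1)] AE_all_countable using scalar by simp
  then have "AE i in leb_I. AE j in leb_I. \<forall>v\<in>C. \<forall>n. v \<bullet> (x T i - x T j) \<le> norm v * (D0 * exp (1 / Suc n - J))"
    by (simp add: AE_ball_countable[OF C(1)] AE_all_countable)
  moreover have "norm (x T i - x T j) \<le> D0 * exp (- J)"
    if *: "\<forall>v\<in>C. \<forall>n. v \<bullet> (x T i - x T j) \<le> norm v * (D0 * exp (1 / Suc n - J))" for i j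
  proof -
    have "norm (x T i - x T j) \<le> D0 * exp (1 / Suc n - J)" for n
      by (rule norm_le_of_dense[OF _ C(2)]) (use * D0 in auto)
    moreover have "(\<lambda>n. D0 * exp (1 / Suc n - J)) \<longlonglongrightarrow> D0 * exp (0 - J)"
      by (intro tendsto_intros LIMSEQ_Suc lim_1_over_n)
    ultimately show ?thesis
      by (intro LIMSEQ_le_const[of _ "D0 * exp (- J)"]) auto
  qed
  ultimately have "AE i in leb_I. AE j in leb_I. norm (x T i - x T j) \<le> D0 * exp (- J)"
    by (auto elim!: eventually_mono)
  moreover have "{z \<in> {0..1} \<times> {0..1}. norm (x T (fst z) - x T (snd z)) \<le> D0 * exp (- J)} \<in> sets leb_II"
  proof -
    have "(\<lambda>z. norm (x T (fst z) - x T (snd z))) \<in> borel_measurable leb_II"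
      using borel_measurable_norm_diff_leb_II[of "x T"] xL2[OF T] by (simp add: in_L2_def case_prod_beta')
    then have "{z \<in> space leb_II. norm (x T (fst z) - x T (snd z)) \<le> D0 * exp (- J)} \<in> sets leb_II"
      by measurable
    then show ?thesis by simp
  qed
  ultimately show ?thesis
    unfolding J_def[symmetric] by (intro AE_lebesgue_on_TimesI) auto
qed

section \<open>The lower bound on the interaction and the theorem\<close>

lemma gamma_min_properties:
  assumes R: "0 < R" and cont: "continuous_on {0..} \<phi>" and pos: "\<And>r. r \<ge> 0 \<Longrightarrow> \<phi> r > 0"
  shows "0 < gamma_min \<phi> R" and "\<And>r. r \<in> {0..2 * R} \<Longrightarrow> gamma_min \<phi> R \<le> \<phi> r"
proof -
  have "continuous_on {0..2 * R} \<phi>" by (rule continuous_on_subset[OF cont]) auto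
  then obtain r0 where r0: "r0 \<in> {0..2 * R}" "\<And>r. r \<in> {0..2 * R} \<Longrightarrow> \<phi> r0 \<le> \<phi> r"
    using continuous_attains_inf[of "{0..2 * R}" \<phi>] R by auto
  have "gamma_min \<phi> R = \<phi> r0"
    unfolding gamma_min_def by (rule Least_equality) (use r0 in auto)
  then show "0 < gamma_min \<phi> R" and "\<And>r. r \<in> {0..2 * R} \<Longrightarrow> gamma_min \<phi> R \<le> \<phi> r"
    using r0 pos by auto
qed

theorem theorem3p3:
  fixes R :: real
    and x0 :: "real \<Rightarrow> real ^ 'd"
    and a :: "real \<Rightarrow> real \<Rightarrow> real \<Rightarrow> real"
    and \<phi> :: "real \<Rightarrow> real"
    and x :: "real \<Rightarrow> real \<Rightarrow> real ^ 'd"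
  assumes "R > 0"
    and "in_Linf x0" and "norm_Linf x0 \<le> ereal R"
    and "(\<lambda>(t, i, j). a t i j) \<in> borel_measurable (lebesgue_on ({0..} \<times> {0..1} \<times> {0..1}))"
    and "\<And>t i j. t \<ge> 0 \<Longrightarrow> i \<in> {0..1} \<Longrightarrow> j \<in> {0..1} \<Longrightarrow> a t i j \<in> {0..1}"
    and "local_lipschitz (UNIV :: real set) {0..} (\<lambda>_. \<phi>)"
    and "\<And>r. r \<ge> 0 \<Longrightarrow> \<phi> r > 0"
    and "bounded (\<phi> ` {0..})"
    and "graphon_solution a \<phi> x0 x"
  shows "\<forall>t\<ge>0. diam_ess (x t) \<le>
           diam_ess (x 0) *
             ereal (exp (- gamma_min \<phi> R * (LINT s|lebesgue_on {0..t}. scrambling_coeff (a s))))"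
proof (intro allI impI)
  fix T :: real assume T: "0 \<le> T"
  interpret I: prob_space leb_I by (rule prob_space_leb_I)
  interpret II: prob_space leb_II by (rule prob_space_leb_II)
  have lip: "Lip_loc_L2 x" and x0: "AE i in leb_I. x 0 i = x0 i"
    and sol: "AE t in lebesgue_on {0..}. has_L2_derivative x (graphon_rhs (a t) \<phi> (x t)) t"
    using assms(9) by (auto simp: graphon_solution_def)
  have xm: "x t \<in> borel_measurable leb_I" if "0 \<le> t" for t
    using lip that by (auto simp: Lip_loc_L2_def in_L2_def)
  have cont: "continuous_on {0..} \<phi>"
    by (rule local_lipschitz_continuous_on[OF assms(6)]) auto
  obtain \<Phi> where \<Phi>: "\<And>r. 0 \<le> r \<Longrightarrow> \<phi> r \<le> \<Phi>"
    using assms(8) by (auto simp: bounded_iff) (metis abs_ge_self atLeast_iff order_trans)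
  \<comment> \<open>Continuity of \<phi> is known on the half-line only. Composition with the
    absolute value gives a function continuous on all reals and agrees with \<phi> at every
    distance.\<close>
  have \<phi>abs: "(\<lambda>r. \<phi> \<bar>r\<bar>) \<in> borel_measurable borel"
    by (intro borel_measurable_continuous_onI continuous_on_compose2[OF cont] continuous_intros) auto
  note \<gamma> = gamma_min_properties[OF assms(1) cont assms(7)]
  define \<eta> where "\<eta> t = scrambling_coeff (a t)" for t
  have \<eta>: "0 \<le> \<eta> t" "\<eta> t \<le> 1"
    "AE i in leb_I. AE j in leb_I. \<eta> t \<le> (LINT l|leb_I. min (a t i l) (a t j l))" if "0 \<le> t" for t
    using scrambling_coeff_bounds[of "a t"] assms(5)[OF that]
      AE_lebesgue_on_TimesD[of "{0..1}" "{0..1}" "\<lambda>z. \<eta> t \<le> (LINT l|leb_I. min (a t (fst z) l) (a t (snd z) l))"]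
    by (auto simp: \<eta>_def)
  have diam_m: "(\<lambda>(i, j). ereal (norm (x t i - x t j))) \<in> borel_measurable leb_II" if "0 \<le> t" for t
    using borel_measurable_norm_diff_leb_II[OF xm[OF that]] by (simp add: case_prod_beta')

  \<comment> \<open>One statement for both passes: the contraction estimate is conditional on
    distances at most \<open>2 * R\<close>, which only the first pass establishes. That pass uses
    the unconditional conjuncts alone.\<close>
  have kernel: "AE t in lebesgue. 0 \<le> t \<longrightarrow> (\<exists>K V. has_L2_derivative x V t \<and>
      case_prod K \<in> borel_measurable (leb_I \<Otimes>\<^sub>M leb_I) \<and> (\<forall>i k. 0 \<le> K i k \<and> K i k \<le> \<Phi>) \<and>
      (AE i in leb_I. V i = (LINT k|leb_I. K i k *\<^sub>R (x t k - x t i))) \<and>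
      ((AE i in leb_I. AE j in leb_I. norm (x t i - x t j) \<le> 2 * R) \<longrightarrow>
        (AE i in leb_I. AE j in leb_I. gamma_min \<phi> R * \<eta> t \<le> (LINT k|leb_I. min (K i k) (K j k)))))"
  proof -
    have "AE t in lebesgue. 0 \<le> t \<longrightarrow> (\<exists>b. case_prod b \<in> borel_measurable (leb_I \<Otimes>\<^sub>M leb_I) \<and>
        (\<forall>i j. 0 \<le> b i j \<and> b i j \<le> 1) \<and> (AE i in leb_I. AE j in leb_I. a t i j = b i j))"
      using AE_kernel_borel_representative[OF assms(4,5)] by (simp add: AE_restrict_space_iff)
    moreover have "AE t in lebesgue. 0 \<le> t \<longrightarrow> has_L2_derivative x (graphon_rhs (a t) \<phi> (x t)) t"
      using sol by (simp add: AE_restrict_space_iff)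
    ultimately show ?thesis
    proof (eventually_elim, intro impI)
      fix t assume "0 \<le> t \<longrightarrow> (\<exists>b. case_prod b \<in> borel_measurable (leb_I \<Otimes>\<^sub>M leb_I) \<and>
          (\<forall>i j. 0 \<le> b i j \<and> b i j \<le> 1) \<and> (AE i in leb_I. AE j in leb_I. a t i j = b i j))"
        and "0 \<le> t \<longrightarrow> has_L2_derivative x (graphon_rhs (a t) \<phi> (x t)) t" and t: "0 \<le> t"
      then obtain b where b: "case_prod b \<in> borel_measurable (leb_I \<Otimes>\<^sub>M leb_I)" "\<And>i j. 0 \<le> b i j \<and> b i j \<le> 1"
          and ab: "AE i in leb_I. AE j in leb_I. a t i j = b i j"
        and deriv: "has_L2_derivative x (graphon_rhs (a t) \<phi> (x t)) t" by blast
      \<comment> \<open>The interaction strength along the solution becomes part of the weight, with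
        the Borel version \<open>b\<close> in place of \<open>a\<close>.\<close>
      define K where "K i k = b i k * \<phi> (norm (x t i - x t k))" for i k
      have [measurable]: "x t \<in> borel_measurable leb_I" by (rule xm[OF t])
      note [measurable] = b(1) \<phi>abs
      have \<phi>n: "0 < \<phi> (norm y)" "\<phi> (norm y) \<le> \<Phi>" for y :: "real ^ 'd"
        using assms(7) \<Phi> by auto
      have Km: "case_prod K \<in> borel_measurable (leb_I \<Otimes>\<^sub>M leb_I)"
      proof -
        have "(\<lambda>z. b (fst z) (snd z) * \<phi> \<bar>norm (x t (fst z) - x t (snd z))\<bar>) \<in> borel_measurable (leb_I \<Otimes>\<^sub>M leb_I)"
          by measurable
        then show ?thesis by (simp add: K_def case_prod_beta')
      qed
      have K: "0 \<le> K i k \<and> K i k \<le> \<Phi>" for i k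
        using b(2)[of i k] \<phi>n[of "x t i - x t k"] mult_mono[of "b i k" 1 "\<phi> (norm (x t i - x t k))" \<Phi>]
        by (auto simp: K_def)
      have sec: "(\<lambda>k. h i k) \<in> borel_measurable leb_I"
        if "case_prod h \<in> borel_measurable (leb_I \<Otimes>\<^sub>M leb_I)" "i \<in> space leb_I" for h :: "real \<Rightarrow> real \<Rightarrow> real" and i
        using measurable_Pair2[OF that] by simp
      have eq: "AE i in leb_I. graphon_rhs (a t) \<phi> (x t) i = (LINT k|leb_I. K i k *\<^sub>R (x t k - x t i))"
        using ab AE_space
      proof eventually_elim
        case (elim i)
        note [measurable] = sec[OF Km elim(2)]
        show ?case unfolding graphon_rhs_def
        proof (rule integral_leb_I_cong_AE)
          show "AE k in leb_I. (a t i k * \<phi> (norm (x t i - x t k))) *\<^sub>R (x t k - x t i) = K i k *\<^sub>R (x t k - x t i)"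
            using elim(1) by eventually_elim (simp add: K_def)
        qed measurable
      qed
      have "AE i in leb_I. AE j in leb_I. gamma_min \<phi> R * \<eta> t \<le> (LINT k|leb_I. min (K i k) (K j k))"
        if near: "AE i in leb_I. AE j in leb_I. norm (x t i - x t j) \<le> 2 * R"
        using \<eta>(3)[OF t] ab near AE_space
      proof eventually_elim
        case (elim i)
        note i = elim
        show ?case using i(1) ab near AE_space
        proof eventually_elim
          case (elim j)
          note j = elim
          note [measurable] = sec[OF b(1) i(4)] sec[OF b(1) j(4)] sec[OF Km i(4)] sec[OF Km j(4)]
          have "AE l in leb_I. min (a t i l) (a t j l) = min (b i l) (b j l)"
            using i(2) j(2) by eventually_elim simp
          then have "(LINT l|leb_I. min (a t i l) (a t j l)) = (LINT l|leb_I. min (b i l) (b j l))"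
            by (rule integral_leb_I_cong_AE) measurable
          then have "gamma_min \<phi> R * \<eta> t \<le> gamma_min \<phi> R * (LINT l|leb_I. min (b i l) (b j l))"
            using j(1) \<gamma>(1) by (intro mult_left_mono) auto
          also have "\<dots> = (LINT l|leb_I. gamma_min \<phi> R * min (b i l) (b j l))" by simp
          \<comment> \<open>For almost every \<open>l\<close>, both \<open>i\<close> and
            \<open>j\<close> lie within \<open>2 * R\<close> of \<open>l\<close>, so \<phi> is at
            least \<open>gamma_min\<close> at both distances and the common overlap of
            \<open>b\<close> survives in each argument of the minimum.\<close>
          also have "\<dots> \<le> (LINT l|leb_I. min (K i l) (K j l))"
          proof (rule integral_mono_AE)
            show "integrable leb_I (\<lambda>l. gamma_min \<phi> R * min (b i l) (b j l))"
              using b(2) by (intro integrable_mult_right I.integrable_const_bound[of _ 1] AE_I2) (auto simp: min_def)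
            show "integrable leb_I (\<lambda>l. min (K i l) (K j l))"
              using K by (intro I.integrable_const_bound[of _ \<Phi>] AE_I2) (auto simp: min_def)
            show "AE l in leb_I. gamma_min \<phi> R * min (b i l) (b j l) \<le> min (K i l) (K j l)"
              using i(3) j(3)
            proof eventually_elim
              case (elim l)
              have "gamma_min \<phi> R * min (b i l) (b j l) \<le> b m l * \<phi> (norm (x t m - x t l))"
                if "norm (x t m - x t l) \<le> 2 * R" "m = i \<or> m = j" for m
              proof -
                have "min (b i l) (b j l) * gamma_min \<phi> R \<le> b m l * \<phi> (norm (x t m - x t l))"
                  using that b(2)[of m l] \<gamma> by (intro mult_mono) auto
                then show ?thesis by (simp add: mult.commute)
              qed
              then show ?case using elim by (simp add: K_def)
            qed
          qed
          finally show ?case .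
        qed
      qed
      then show "\<exists>K V. has_L2_derivative x V t \<and>
        case_prod K \<in> borel_measurable (leb_I \<Otimes>\<^sub>M leb_I) \<and> (\<forall>i k. 0 \<le> K i k \<and> K i k \<le> \<Phi>) \<and>
        (AE i in leb_I. V i = (LINT k|leb_I. K i k *\<^sub>R (x t k - x t i))) \<and>
        ((AE i in leb_I. AE j in leb_I. norm (x t i - x t j) \<le> 2 * R) \<longrightarrow>
          (AE i in leb_I. AE j in leb_I. gamma_min \<phi> R * \<eta> t \<le> (LINT k|leb_I. min (K i k) (K j k))))"
        using deriv Km K eq by (intro exI[of _ K] exI[of _ "graphon_rhs (a t) \<phi> (x t)"]) blast
    qed
  qed

  \<comment> \<open>The triangle inequality with the bound \<open>R\<close> on the initial state
    makes the initial diameter finite, so a real barrier can start there. It is nonnegative because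
    the square has positive measure.\<close>
  obtain D0 where D0: "diam_ess (x 0) = ereal D0" "0 \<le> D0" "D0 \<le> 2 * R"
  proof -
    have "AE i in leb_I. ereal (norm (x0 i)) \<le> norm_Linf x0" unfolding norm_Linf_def by (rule esssup_AE)
    then have b: "AE i in leb_I. norm (x 0 i) \<le> R"
      using x0
    proof eventually_elim
      case (elim i)
      then have "ereal (norm (x0 i)) \<le> ereal R" using assms(3) by (meson order_trans)
      then show ?case using elim by simp
    qed
    have "AE i in leb_I. AE j in leb_I. norm (x 0 i - x 0 j) \<le> 2 * R"
      using b
    proof eventually_elim
      case (elim i)
      from b show ?case
      proof eventually_elim
        case (elim j)
        then show ?case using \<open>norm (x 0 i) \<le> R\<close> norm_triangle_ineq4[of "x 0 i" "x 0 j"] by linarith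
      qed
    qed
    moreover have "{z \<in> space leb_II. norm (x 0 (fst z) - x 0 (snd z)) \<le> 2 * R} \<in> sets leb_II"
      using borel_measurable_norm_diff_leb_II[OF xm, of 0] unfolding case_prod_beta' by measurable
    ultimately have "AE z in leb_II. norm (x 0 (fst z) - x 0 (snd z)) \<le> 2 * R"
      by (intro AE_lebesgue_on_TimesI) auto
    then have "diam_ess (x 0) \<le> ereal (2 * R)"
      unfolding diam_ess_def using diam_m[of 0] by (intro esssup_I) (auto simp: case_prod_beta')
    moreover have "0 \<le> diam_ess (x 0)"
    proof -
      have "esssup leb_II (\<lambda>z. 0 :: ereal) = 0"
        by (rule esssup_const) (use II.emeasure_space_1 in force)
      moreover have "esssup leb_II (\<lambda>z. 0 :: ereal) \<le> diam_ess (x 0)"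
        unfolding diam_ess_def by (intro esssup_AE_mono AE_I2) auto
      ultimately show ?thesis by simp
    qed
    ultimately show ?thesis using that by (cases "diam_ess (x 0)") auto
  qed
  have init: "AE z in leb_II. norm (x 0 (fst z) - x 0 (snd z)) \<le> D0"
    using esssup_AE[of "\<lambda>(i, j). ereal (norm (x 0 i - x 0 j))" leb_II] D0(1)
    by (simp add: diam_ess_def case_prod_beta')

  \<comment> \<open>First pass, with rate 0: the exponential factor is 1. Since
    \<open>D0 \<le> 2 * R\<close>, the result discharges the premise of the contraction estimate in
    \<open>kernel\<close> at every time.\<close>
  have noninc: "AE z in leb_II. norm (x t (fst z) - x t (snd z)) \<le> D0" if t: "0 \<le> t" for t
  proof -
    have "AE z in leb_II. norm (x t (fst z) - x t (snd z)) \<le> D0 * exp (- (LINT s|lebesgue_on {0..t}. 0))"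
    proof (rule diameter_decay[OF lip t _ _ _ D0(2) init, where G = 0 and \<Phi> = \<Phi>])
      show "AE s in lebesgue. s \<in> {0..<t} \<longrightarrow> (\<exists>K V. has_L2_derivative x V s \<and>
        case_prod K \<in> borel_measurable (leb_I \<Otimes>\<^sub>M leb_I) \<and> (\<forall>i k. 0 \<le> K i k \<and> K i k \<le> \<Phi>) \<and>
        (AE i in leb_I. V i = (LINT k|leb_I. K i k *\<^sub>R (x s k - x s i))) \<and>
        (AE i in leb_I. AE j in leb_I. 0 \<le> (LINT k|leb_I. min (K i k) (K j k))))"
        using kernel
      proof (eventually_elim, intro impI)
        fix s assume *: "0 \<le> s \<longrightarrow> (\<exists>K V. has_L2_derivative x V s \<and>
          case_prod K \<in> borel_measurable (leb_I \<Otimes>\<^sub>M leb_I) \<and> (\<forall>i k. 0 \<le> K i k \<and> K i k \<le> \<Phi>) \<and>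
          (AE i in leb_I. V i = (LINT k|leb_I. K i k *\<^sub>R (x s k - x s i))) \<and>
          ((AE i in leb_I. AE j in leb_I. norm (x s i - x s j) \<le> 2 * R) \<longrightarrow>
            (AE i in leb_I. AE j in leb_I. gamma_min \<phi> R * \<eta> s \<le> (LINT k|leb_I. min (K i k) (K j k)))))"
          and s: "s \<in> {0..<t}"
        then obtain K V where KV: "has_L2_derivative x V s"
          "case_prod K \<in> borel_measurable (leb_I \<Otimes>\<^sub>M leb_I)" "\<forall>i k. 0 \<le> K i k \<and> K i k \<le> \<Phi>"
          "AE i in leb_I. V i = (LINT k|leb_I. K i k *\<^sub>R (x s k - x s i))" by auto
        have "0 \<le> (LINT k|leb_I. min (K i k) (K j k))" for i j
          using KV(3) by (intro Bochner_Integration.integral_nonneg) auto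
        then show "\<exists>K V. has_L2_derivative x V s \<and>
          case_prod K \<in> borel_measurable (leb_I \<Otimes>\<^sub>M leb_I) \<and> (\<forall>i k. 0 \<le> K i k \<and> K i k \<le> \<Phi>) \<and>
          (AE i in leb_I. V i = (LINT k|leb_I. K i k *\<^sub>R (x s k - x s i))) \<and>
          (AE i in leb_I. AE j in leb_I. 0 \<le> (LINT k|leb_I. min (K i k) (K j k)))"
          using KV by (intro exI[of _ K] exI[of _ V]) simp
      qed
    qed auto
    then show ?thesis by simp
  qed

  have "AE z in leb_II. norm (x T (fst z) - x T (snd z))
      \<le> D0 * exp (- gamma_min \<phi> R * (LINT s|lebesgue_on {0..T}. \<eta> s))"
  proof (cases "integrable (lebesgue_on {0..T}) \<eta>")
    case True
    have "AE z in leb_II. norm (x T (fst z) - x T (snd z))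
        \<le> D0 * exp (- (LINT s|lebesgue_on {0..T}. gamma_min \<phi> R * \<eta> s))"
    proof (rule diameter_decay[OF lip T _ _ _ D0(2) init, where G = "gamma_min \<phi> R" and \<Phi> = \<Phi>])
      show "(\<lambda>s. gamma_min \<phi> R * \<eta> s) \<in> borel_measurable (lebesgue_on {0..T})" using True by simp
      show "0 \<le> gamma_min \<phi> R * \<eta> s \<and> gamma_min \<phi> R * \<eta> s \<le> gamma_min \<phi> R" if "s \<in> {0..T}" for s
        using \<eta>[of s] \<gamma>(1) that mult_left_mono[of "\<eta> s" 1 "gamma_min \<phi> R"] by simp
      show "AE s in lebesgue. s \<in> {0..<T} \<longrightarrow> (\<exists>K V. has_L2_derivative x V s \<and>
        case_prod K \<in> borel_measurable (leb_I \<Otimes>\<^sub>M leb_I) \<and> (\<forall>i k. 0 \<le> K i k \<and> K i k \<le> \<Phi>) \<and>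
        (AE i in leb_I. V i = (LINT k|leb_I. K i k *\<^sub>R (x s k - x s i))) \<and>
        (AE i in leb_I. AE j in leb_I. gamma_min \<phi> R * \<eta> s \<le> (LINT k|leb_I. min (K i k) (K j k))))"
        using kernel
      proof (eventually_elim, intro impI)
        fix s assume *: "0 \<le> s \<longrightarrow> (\<exists>K V. has_L2_derivative x V s \<and>
          case_prod K \<in> borel_measurable (leb_I \<Otimes>\<^sub>M leb_I) \<and> (\<forall>i k. 0 \<le> K i k \<and> K i k \<le> \<Phi>) \<and>
          (AE i in leb_I. V i = (LINT k|leb_I. K i k *\<^sub>R (x s k - x s i))) \<and>
          ((AE i in leb_I. AE j in leb_I. norm (x s i - x s j) \<le> 2 * R) \<longrightarrow>
            (AE i in leb_I. AE j in leb_I. gamma_min \<phi> R * \<eta> s \<le> (LINT k|leb_I. min (K i k) (K j k)))))"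
          and s: "s \<in> {0..<T}"
        have "AE i in leb_I. AE j in leb_I. norm (x s i - x s j) \<le> D0"
          using AE_lebesgue_on_TimesD[OF _ _ noninc[of s]] s by simp
        then have "AE i in leb_I. AE j in leb_I. norm (x s i - x s j) \<le> 2 * R"
          using D0(3) by (auto elim!: eventually_mono)
        then show "\<exists>K V. has_L2_derivative x V s \<and>
          case_prod K \<in> borel_measurable (leb_I \<Otimes>\<^sub>M leb_I) \<and> (\<forall>i k. 0 \<le> K i k \<and> K i k \<le> \<Phi>) \<and>
          (AE i in leb_I. V i = (LINT k|leb_I. K i k *\<^sub>R (x s k - x s i))) \<and>
          (AE i in leb_I. AE j in leb_I. gamma_min \<phi> R * \<eta> s \<le> (LINT k|leb_I. min (K i k) (K j k)))"
          using * s by auto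
      qed
    qed
    then show ?thesis by simp
  next
    case False
    \<comment> \<open>A non-integrable \<open>\<eta>\<close> has integral 0 by convention, so the
      claimed bound is \<open>D0\<close> itself.\<close>
    then show ?thesis using noninc[OF T] by (simp add: not_integrable_integral_eq)
  qed
  then have "diam_ess (x T) \<le> ereal (D0 * exp (- gamma_min \<phi> R * (LINT s|lebesgue_on {0..T}. \<eta> s)))"
    unfolding diam_ess_def using diam_m[OF T] by (intro esssup_I) (auto simp: case_prod_beta')
  then show "diam_ess (x T) \<le>
      diam_ess (x 0) * ereal (exp (- gamma_min \<phi> R * (LINT s|lebesgue_on {0..T}. scrambling_coeff (a s))))"
    by (simp add: D0(1) \<eta>_def)
qed

end
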